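(* Let $0<\beta<1$, $x_0>0$, $0\le\mu<1$ and $p>1/\beta$. Assume: (1) $\phi$ is a nonnegative, continuous and nondecreasing function on $[0,+\infty)$, and there exists a nonnegative constant $M$ such that $|\phi(t)|\le M t^{\mu}$ for all $t\in[0,+\infty)$; (2) $t^{\beta}l(t)$ is a nonnegative, continuous and nonincreasing function on $(0,+\infty)$, and $t^{(1-\mu)(1-\beta)}l(t)\in L^{p}[0,1]$; (3) $t^{\beta}k(t)$ is a nonnegative, continuous and nonincreasing function on $(0,+\infty)$, and $t^{1-\beta}k(t)\in L^{p}[0,1]$. Let $a=\lim_{t\to+\infty}t^{\beta}l(t)$ and $b=\lim_{t\to+\infty}t^{\beta}k(t)$ (these limits exist by monotonicity), and let $x^{*}$ be the largest solution in $[0,+\infty)$ of the equation $$x=\frac{\pi}{\Gamma(\beta)\sin(\beta\pi)}\bigl(a\phi(x)+b\bigr).$$ Then the Riemann-Liouville fractional differential equation $$D_{0^{+}}^{\beta}x(t)=l(t)\phi(x(t))+k(t),\quad t\in(0,+\infty),\qquad \lim_{t\to0^{+}}t^{1-\beta}x(t)=x_{0},$$ has at least one decreasing solution $x\in C^{+}_{1-\beta}(0,+\infty)$ with $\lim_{t\to+\infty}x(t)=x^{*}$.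
   Context: The Riemann-Liouville fractional integral of order $\alpha\in(0,1)$ is $I_{0^{+}}^{\alpha}\rho(t)=\frac{1}{\Gamma(\alpha)}\int_{0}^{t}(t-s)^{\alpha-1}\rho(s)\,ds$. The Riemann-Liouville fractional derivative of order $\beta\in(0,1)$ is $D_{0^{+}}^{\beta}\rho(t)=\frac{d}{dt}I_{0^{+}}^{1-\beta}\rho(t)=\frac{1}{\Gamma(1-\beta)}\frac{d}{dt}\int_{0}^{t}(t-s)^{-\beta}\rho(s)\,ds$, where $I_{0^{+}}^{1-\beta}\rho$ is an absolutely continuous function. For $\alpha\in(0,1)$, $C^{+}_{\alpha}(0,+\infty)$ is the set of nonnegative continuous functions $x$ on $(0,+\infty)$ such that $t^{\alpha}x(t)$ is (extends to) a nonnegative continuous function on $[0,+\infty)$. A solution is a function satisfying both the differential equation for all $t\in(0,+\infty)$ and the initial condition. "Decreasing" means strictly decreasing, as distinguished from "nonincreasing". When $\mu=0$, $t^{\mu}=1$ for all $t\ge0$, including $t=0$. *)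

theory Defs
  imports "HOL-Analysis.Analysis"
begin

(* Library powr has 0 powr 0 = 0; here t^0 = 1 also at t = 0. *)
definition rpow :: "real \<Rightarrow> real \<Rightarrow> real" where
  "rpow t \<mu> = (if \<mu> = 0 then 1 else t powr \<mu>)"

definition in_Lp :: "real \<Rightarrow> real set \<Rightarrow> (real \<Rightarrow> real) \<Rightarrow> bool" where
  "in_Lp p S f \<longleftrightarrow>
     f \<in> borel_measurable (lebesgue_on S) \<and>
     integrable (lebesgue_on S) (\<lambda>t. \<bar>f t\<bar> powr p)"

(* Epsilon-delta absolute continuity: the sums range over finite families of
   non-overlapping intervals [u i, v i] contained in S. *)
definition abs_continuous_on :: "real set \<Rightarrow> (real \<Rightarrow> real) \<Rightarrow> bool" where
  "abs_continuous_on S f \<longleftrightarrow>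
     (\<forall>\<epsilon>>0. \<exists>\<delta>>0. \<forall>(n::nat) u v.
        (\<forall>i<n. u i \<le> v i \<and> {u i..v i} \<subseteq> S) \<and>
        (\<forall>i<n. \<forall>j<n. i \<noteq> j \<longrightarrow> {u i<..<v i} \<inter> {u j<..<v j} = {}) \<and>
        (\<Sum>i<n. v i - u i) < \<delta> \<longrightarrow>
        (\<Sum>i<n. \<bar>f (v i) - f (u i)\<bar>) < \<epsilon>)"

definition RL_integrable :: "real \<Rightarrow> (real \<Rightarrow> real) \<Rightarrow> real \<Rightarrow> bool" where
  "RL_integrable \<alpha> \<rho> t \<longleftrightarrow>
     set_integrable lebesgue {0<..<t} (\<lambda>s. (t - s) powr (\<alpha> - 1) * \<rho> s)"

definition RL_integral :: "real \<Rightarrow> (real \<Rightarrow> real) \<Rightarrow> real \<Rightarrow> real" where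
  "RL_integral \<alpha> \<rho> t =
     1 / Gamma \<alpha> * (LINT s:{0<..<t}|lebesgue. (t - s) powr (\<alpha> - 1) * \<rho> s)"

(* The Riemann-Liouville derivative of order \<beta> of \<rho> exists at t and equals D.
   Absolute continuity of the fractional integral is required on every (0, T]
   rather than [0, T]: its value at 0 is not determined by the formula (the
   integral over the empty interval is 0, whereas e.g. for \<rho> t = t powr (\<beta> - 1) the
   limit at 0 is Gamma \<beta>), and absolute continuity on (0, T] is equivalent to
   absolute continuity on [0, T] of its continuous extension. *)
definition has_RL_derivative :: "real \<Rightarrow> (real \<Rightarrow> real) \<Rightarrow> real \<Rightarrow> real \<Rightarrow> bool" where
  "has_RL_derivative \<beta> \<rho> D t \<longleftrightarrow>
     (\<forall>s>0. RL_integrable (1 - \<beta>) \<rho> s) \<and>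
     (\<forall>T>0. abs_continuous_on {0<..T} (RL_integral (1 - \<beta>) \<rho>)) \<and>
     (RL_integral (1 - \<beta>) \<rho> has_real_derivative D) (at t)"

(* The space C^+_alpha(0,infinity); values of x outside (0,infinity) are irrelevant. *)
definition Cplus :: "real \<Rightarrow> (real \<Rightarrow> real) set" where
  "Cplus \<alpha> = {x. continuous_on {0<..} x \<and> (\<forall>t>0. 0 \<le> x t) \<and>
     (\<exists>y. continuous_on {0..} y \<and> (\<forall>t\<ge>0. 0 \<le> y t) \<and>
          (\<forall>t>0. y t = t powr \<alpha> * x t))}"

definition RL_ivp_solution ::
  "real \<Rightarrow> (real \<Rightarrow> real) \<Rightarrow> (real \<Rightarrow> real) \<Rightarrow> (real \<Rightarrow> real) \<Rightarrow> real \<Rightarrow> (real \<Rightarrow> real) \<Rightarrow> bool" where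
  "RL_ivp_solution \<beta> l k \<phi> x0 x \<longleftrightarrow>
     (\<forall>t>0. has_RL_derivative \<beta> x (l t * \<phi> (x t) + k t) t) \<and>
     ((\<lambda>t. t powr (1 - \<beta>) * x t) \<longlongrightarrow> x0) (at_right 0)"

definition largest_nonneg_solution :: "(real \<Rightarrow> real) \<Rightarrow> real \<Rightarrow> bool" where
  "largest_nonneg_solution F z \<longleftrightarrow>
     0 \<le> z \<and> z = F z \<and> (\<forall>y\<ge>0. y = F y \<longrightarrow> y \<le> z)"

end

theory Submission
  imports Defs
begin

text \<open>Put $g(s) = s^\beta (l(s)\phi(x(s)) + k(s))$. The fractional
equation with its initial condition follows from the Volterra equation
\[ x(t) = x_0 t^{\beta-1} + \frac{1}{\Gamma(\beta)} \int_0^t (t-s)^{\beta-1} s^{-\beta} g(s)\,ds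
        = x_0 t^{\beta-1} + \frac{1}{\Gamma(\beta)} \int_0^1 (1-\tau)^{\beta-1}\tau^{-\beta} g(t\tau)\,d\tau . \]
The second form, obtained from $s = t\tau$, drives the whole argument: if $x$ is nonincreasing
then so is $g$, hence so is the average of $g(t\tau)$ as a function of $t$, and the term
$x_0 t^{\beta-1}$ makes the right-hand side strictly decreasing.

The $L^p$ hypotheses enter only through pointwise bounds. A function $t^\gamma l(t)$ in $L^p[0,1]$
with $t^\beta l(t)$ nonincreasing is at most $C t^{-1/p}$ on $(0,1]$ (\<open>Lp_antimono_pointwise_bound\<close>),
and then every integral is a Beta integral. With $\delta = \beta - 1/p > 0$, the right-hand side
of the differential equation is $O(s^{\delta-1})$ at $0$ along functions of size $O(s^{\beta-1})$.
Since $\phi$ grows at most like $t^\mu$ with $\mu < 1$, the operator on the right of the Volterra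
equation maps the nonincreasing functions between $0$ and $A \max(1, t^{\beta-1})$ into themselves
once $A$ is large. It is monotone, so Knaster and Tarski's construction gives a greatest fixed
point $x$ (\<open>greatest_fixpoint_of_antimono_functions\<close>).

Dominated convergence in the second form shows that the limit $L$ of $x$ at infinity satisfies
$L = F(L)$, where $F(y) = B(1-\beta,\beta)\Gamma(\beta)^{-1}(a\phi(y)+b)$. Conversely, any
constant $y = F(y)$ is a subsolution, because $a$ and $b$ are lower bounds of $t^\beta l(t)$ and
$t^\beta k(t)$; as $x$ dominates all admissible subsolutions, $y \le L$. So $L$ is the largest solution, and
Euler's reflection formula puts $F$ into the form with the sine.

It remains to return to the differential equation. The function $x$ is continuous since a
monotone $g$ is continuous almost everywhere (\<open>beta_avg_continuous\<close>). Tonelli's theorem and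
a Beta integral show that the fractional integral of order $1-\beta$ of $x$ is
$x_0\Gamma(\beta) + \int_0^t s^{-\beta} g(s)\,ds$ (\<open>RL_integral_of_volterra\<close>), which is
absolutely continuous with derivative $t^{-\beta} g(t)$.\<close>

section \<open>Nonincreasing functions on the half line\<close>

lemma antimono_on_measurable:
  fixes g :: "real \<Rightarrow> real"
  assumes "antimono_on {0<..} g"
  shows "(\<lambda>s. indicator {0<..} s * g s) \<in> borel_measurable borel"
proof -
  have "mono_on {0<..} (\<lambda>s. - g s)"
    using assms by (auto simp: monotone_on_def)
  then have "(\<lambda>s. - g s) \<in> borel_measurable (restrict_space borel {0<..})"
    by (rule borel_measurable_mono_on_fnc)
  then have "(\<lambda>s. - (- g s)) \<in> borel_measurable (restrict_space borel {0<..})"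
    by measurable
  then show ?thesis
    by (subst (asm) borel_measurable_restrict_space_iff) auto
qed

lemma antimono_limit_lower_bound:
  fixes g :: "real \<Rightarrow> real"
  assumes "antimono_on {0<..} g" "(g \<longlongrightarrow> c) at_top" "s > 0"
  shows "c \<le> g s"
proof (rule tendsto_upperbound[OF assms(2)])
  show "\<forall>\<^sub>F t in at_top. g t \<le> g s"
    using eventually_ge_at_top[of s]
    by eventually_elim (use assms in \<open>auto simp: monotone_on_def\<close>)
qed simp

lemma antimono_nonneg_convergent:
  fixes x :: "real \<Rightarrow> real"
  assumes am: "antimono_on {0<..} x" and nn: "\<And>t. t > 0 \<Longrightarrow> 0 \<le> x t"
  shows "\<exists>L\<ge>0. (x \<longlongrightarrow> L) at_top"
proof -
  define L where "L = (INF t\<in>{0<..}. x t)"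
  have bdd: "bdd_below (x ` {0<..})" using nn by (intro bdd_belowI[of _ 0]) auto
  have "(x \<longlongrightarrow> L) at_top"
  proof (rule decreasing_tendsto)
    show "\<forall>\<^sub>F t in at_top. L \<le> x t"
      using eventually_gt_at_top[of 0]
      by eventually_elim (auto simp: L_def intro!: cINF_lower bdd)
    fix y assume "L < y"
    then obtain s where s: "s > 0" "x s < y"
      unfolding L_def by (subst (asm) cINF_less_iff[OF _ bdd]) auto
    show "\<forall>\<^sub>F t in at_top. x t < y"
      using eventually_ge_at_top[of s]
    proof eventually_elim
      case (elim t)
      then have "x t \<le> x s" using s monotone_onD[OF am, of s t] by auto
      with s show ?case by simp
    qed
  qed
  moreover have "L \<ge> 0" unfolding L_def using nn by (intro cINF_greatest) auto
  ultimately show ?thesis by blast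
qed

text \<open>Write $h(t) = t^\gamma l(t) = t^{\gamma-\beta} \cdot t^\beta l(t)$. The first factor varies by at
most a constant factor on $[t/2, t]$ and the second is nonincreasing, so $h \ge c\,h(t)$ on
that interval, whence $\frac{t}{2} (c\,h(t))^p \le \int_0^1 h^p$.\<close>

lemma Lp_antimono_pointwise_bound:
  fixes l :: "real \<Rightarrow> real"
  assumes "p > 0" and nn: "\<And>t. t > 0 \<Longrightarrow> 0 \<le> t powr \<beta> * l t"
    and am: "antimono_on {0<..} (\<lambda>t. t powr \<beta> * l t)"
    and Lp: "in_Lp p {0..1} (\<lambda>t. t powr \<gamma> * l t)"
  shows "\<exists>C. \<forall>t. 0 < t \<and> t \<le> 1 \<longrightarrow> t powr \<gamma> * l t \<le> C * t powr (- 1 / p)"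
proof -
  define h where "h = (\<lambda>t. t powr \<gamma> * l t)"
  \<comment> \<open>\<open>(s / t) powr (\<gamma> - \<beta>) \<ge> c\<close> for \<open>s / t\<close> between \<open>1 / 2\<close> and \<open>1\<close>, whatever the sign of \<open>\<gamma> - \<beta>\<close>.\<close>
  define c where "c = min 1 ((1 / 2) powr (\<gamma> - \<beta>))"
  define I where "I = (\<integral>t. \<bar>h t\<bar> powr p \<partial>lebesgue_on {0..1})"
  have c: "c > 0" by (simp add: c_def)
  have h_eq: "h t = t powr (\<gamma> - \<beta>) * (t powr \<beta> * l t)" if "t > 0" for t
    using that by (simp add: h_def powr_diff)
  have h0: "0 \<le> h t" if "t > 0" for t
    using nn[OF that] that by (simp add: h_eq)
  have cmp: "c * h t \<le> h s" if "0 < t" "t / 2 \<le> s" "s \<le> t" for s t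
  proof -
    have "c * t powr (\<gamma> - \<beta>) \<le> s powr (\<gamma> - \<beta>)"
    proof (cases "\<gamma> - \<beta> \<ge> 0")
      case True
      have "c * t powr (\<gamma> - \<beta>) \<le> (1 / 2) powr (\<gamma> - \<beta>) * t powr (\<gamma> - \<beta>)"
        by (intro mult_right_mono) (auto simp: c_def)
      also have "\<dots> = (t / 2) powr (\<gamma> - \<beta>)"
        using that by (simp flip: powr_mult)
      also have "\<dots> \<le> s powr (\<gamma> - \<beta>)"
        using that True by (intro powr_mono2) auto
      finally show ?thesis .
    next
      case False
      have "c * t powr (\<gamma> - \<beta>) \<le> 1 * t powr (\<gamma> - \<beta>)"
        by (intro mult_right_mono) (auto simp: c_def)
      also have "\<dots> \<le> s powr (\<gamma> - \<beta>)"
        using that False by (simp add: powr_mono2')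
      finally show ?thesis .
    qed
    moreover have "t powr \<beta> * l t \<le> s powr \<beta> * l s"
      using monotone_onD[OF am, of s t] that by auto
    ultimately have "(c * t powr (\<gamma> - \<beta>)) * (t powr \<beta> * l t) \<le> s powr (\<gamma> - \<beta>) * (s powr \<beta> * l s)"
      by (rule mult_mono) (use nn[of t] that in auto)
    then show ?thesis using that by (simp add: h_eq mult.assoc)
  qed
  have "h t \<le> (2 * I) powr (1 / p) / c * t powr (- 1 / p)" if t: "0 < t" "t \<le> 1" for t
  proof -
    have int: "integrable (lebesgue_on {0..1}) (\<lambda>s. \<bar>h s\<bar> powr p)"
      using Lp by (simp add: in_Lp_def h_def)
    then have int': "integrable lebesgue (\<lambda>s. indicator {0..1} s *\<^sub>R (\<bar>h s\<bar> powr p))"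
      by (subst (asm) integrable_restrict_space) auto
    have "t / 2 * (c * h t) powr p = (\<integral>s. indicator {t/2..t} s * (c * h t) powr p \<partial>lebesgue)"
      using t by simp
    also have "\<dots> \<le> (\<integral>s. indicator {0..1} s *\<^sub>R (\<bar>h s\<bar> powr p) \<partial>lebesgue)"
    proof (intro integral_mono int')
      have "integrable lebesgue (indicator {t/2..t} :: real \<Rightarrow> real)"
        by (rule integrable_real_indicator) (use t in auto)
      then show "integrable lebesgue (\<lambda>s. indicator {t/2..t} s * (c * h t) powr p)" by simp
      show "indicator {t/2..t} s * (c * h t) powr p \<le> indicator {0..1} s *\<^sub>R (\<bar>h s\<bar> powr p)" for s
        using cmp[of t s] t c h0[of t] h0[of s] assms(1)
        by (auto simp: indicator_def intro!: powr_mono2)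
    qed
    also have "\<dots> = I"
      unfolding I_def by (subst integral_restrict_space) auto
    finally have "(c * h t) powr p \<le> 2 * I / t"
      using t by (simp add: field_simps)
    then have "((c * h t) powr p) powr (1 / p) \<le> (2 * I / t) powr (1 / p)"
      using assms(1) by (intro powr_mono2) auto
    also have "((c * h t) powr p) powr (1 / p) = c * h t"
      using assms(1) c h0[of t] t by (simp add: powr_powr)
    also have "(2 * I / t) powr (1 / p) = (2 * I) powr (1 / p) * t powr (- 1 / p)"
    proof -
      have "0 \<le> I" unfolding I_def by (intro Bochner_Integration.integral_nonneg) simp
      then show ?thesis using t by (simp add: powr_divide powr_minus divide_simps)
    qed
    finally show ?thesis using c by (simp add: field_simps)
  qed
  then show ?thesis unfolding h_def by blast
qed

section \<open>Averages against the Beta kernel\<close>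

lemma has_bochner_integral_Beta:
  assumes "a > 0" "b > (0::real)"
  shows "has_bochner_integral lborel
           (\<lambda>\<tau>. indicator {0<..<1} \<tau> * (\<tau> powr (a - 1) * (1 - \<tau>) powr (b - 1))) (Beta a b)"
proof -
  have eq: "(\<lambda>\<tau>. indicator {0..1} \<tau> *\<^sub>R (\<tau> powr (a - 1) * (1 - \<tau>) powr (b - 1))) =
        (\<lambda>\<tau>. indicator {0<..<1} \<tau> * (\<tau> powr (a - 1) * (1 - \<tau>) powr (b - 1)))"
    by (rule ext) (auto simp: indicator_def)
  have "(LINT \<tau>:{0..1}|lborel. \<tau> powr (a - 1) * (1 - \<tau>) powr (b - 1)) = Beta a b"
    using set_borel_integral_eq_integral(2)[OF integrable_Beta[OF assms]]
      integral_unique[OF has_integral_Beta_real[OF assms]] by simp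
  then show ?thesis
    using integrable_Beta[OF assms] unfolding has_bochner_integral_iff
    by (simp add: set_integrable_def set_lebesgue_integral_def flip: eq)
qed

lemma Beta_reflection_real:
  fixes \<beta> :: real
  shows "Gamma \<beta> * Gamma (1 - \<beta>) = pi / sin (\<beta> * pi)"
proof -
  have "Gamma (complex_of_real \<beta>) * Gamma (complex_of_real (1 - \<beta>)) =
      complex_of_real pi / sin (complex_of_real (pi * \<beta>))"
    using Gamma_reflection_complex[of "complex_of_real \<beta>"] by simp
  then have "complex_of_real (Gamma \<beta> * Gamma (1 - \<beta>)) = complex_of_real (pi / sin (\<beta> * pi))"
    unfolding Gamma_complex_of_real sin_of_real by (simp add: mult.commute)
  then show ?thesis by (simp only: of_real_eq_iff)
qed

text \<open>The kernel vanishes outside $(0,1)$, so that averages are integrals over the whole line and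
integrands need to be controlled only where $t\tau > 0$.\<close>

definition beta_kernel :: "real \<Rightarrow> real \<Rightarrow> real" where
  "beta_kernel \<beta> \<tau> = indicator {0<..<1} \<tau> * (\<tau> powr (-\<beta>) * (1 - \<tau>) powr (\<beta> - 1))"

definition beta_avg :: "real \<Rightarrow> (real \<Rightarrow> real) \<Rightarrow> real \<Rightarrow> real" where
  "beta_avg \<beta> g t = (\<integral>\<tau>. beta_kernel \<beta> \<tau> * g (t * \<tau>) \<partial>lborel)"

text \<open>The functions that are averaged, playing the role of $g(s) = s^\beta f(s)$ for a right-hand
side $f$. The last bound says $f(s) \le K s^{\delta-1}$ near $0$, which is integrable for
$\delta > 0$; away from $0$ monotonicity already bounds $g$.\<close>

definition profile :: "real \<Rightarrow> real \<Rightarrow> real \<Rightarrow> (real \<Rightarrow> real) \<Rightarrow> bool" where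
  "profile \<beta> \<delta> K g \<longleftrightarrow> antimono_on {0<..} g \<and> (\<forall>s>0. 0 \<le> g s) \<and>
     (\<forall>s. 0 < s \<and> s \<le> 1 \<longrightarrow> g s \<le> K * s powr (\<beta> + \<delta> - 1))"

lemma beta_kernel_nonneg: "0 \<le> beta_kernel \<beta> \<tau>"
  by (simp add: beta_kernel_def)

lemma beta_kernel_measurable [measurable]: "beta_kernel \<beta> \<in> borel_measurable borel"
  unfolding beta_kernel_def by measurable

lemma beta_kernel_integral:
  assumes "0 < \<beta>" "\<beta> < 1"
  shows "has_bochner_integral lborel (beta_kernel \<beta>) (Beta (1 - \<beta>) \<beta>)"
  using has_bochner_integral_Beta[of "1 - \<beta>" \<beta>] assms unfolding beta_kernel_def by simp

text \<open>Multiplying the kernel by the extremal profile $\tau^{\beta+\delta-1}$ gives a Beta integrand.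
This is the dominating function for all averages.\<close>

lemma beta_kernel_powr_integral:
  assumes "0 < \<beta>" "0 < \<delta>"
  shows "has_bochner_integral lborel
           (\<lambda>\<tau>. beta_kernel \<beta> \<tau> * \<tau> powr (\<beta> + \<delta> - 1)) (Beta \<delta> \<beta>)"
proof -
  have "(\<lambda>\<tau>. beta_kernel \<beta> \<tau> * \<tau> powr (\<beta> + \<delta> - 1)) =
     (\<lambda>\<tau>. indicator {0<..<1} \<tau> * (\<tau> powr (\<delta> - 1) * (1 - \<tau>) powr (\<beta> - 1)))"
    by (rule ext) (auto simp: indicator_def beta_kernel_def simp flip: powr_add)
  then show ?thesis
    using has_bochner_integral_Beta[of \<delta> \<beta>] assms by simp
qed

text \<open>A profile is constrained only on the positive half line, which is where the kernel looks at it.\<close>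

lemma beta_integrand_measurable:
  assumes "antimono_on {0<..} g" "t > 0"
  shows "(\<lambda>\<tau>. beta_kernel \<beta> \<tau> * g (t * \<tau>)) \<in> borel_measurable borel"
proof -
  note [measurable] = antimono_on_measurable[OF assms(1)]
  have "(\<lambda>\<tau>. beta_kernel \<beta> \<tau> * g (t * \<tau>)) =
        (\<lambda>\<tau>. beta_kernel \<beta> \<tau> * (\<lambda>s. indicator {0<..} s * g s) (t * \<tau>))"
    using assms(2) by (auto simp: beta_kernel_def indicator_def)
  also have "\<dots> \<in> borel_measurable borel"
    by measurable
  finally show ?thesis .
qed

text \<open>For $t \ge 1$ monotonicity reduces to the case $t = 1$, where the argument $t\tau$ lies in $(0,1)$.\<close>

lemma profile_scaled_bound:
  assumes "profile \<beta> \<delta> K g" "t > 0" "0 < \<tau>" "\<tau> < 1"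
  shows "g (t * \<tau>) \<le> K * min t 1 powr (\<beta> + \<delta> - 1) * \<tau> powr (\<beta> + \<delta> - 1)"
proof -
  have *: "0 < min t 1 * \<tau>" "min t 1 * \<tau> \<le> t * \<tau>" "min t 1 * \<tau> \<le> 1"
    using assms by (auto simp: min_def intro: mult_le_one)
  have "g (t * \<tau>) \<le> g (min t 1 * \<tau>)"
    using assms * by (auto simp: profile_def monotone_on_def)
  also have "\<dots> \<le> K * (min t 1 * \<tau>) powr (\<beta> + \<delta> - 1)"
    using assms * by (auto simp: profile_def)
  also have "\<dots> = K * min t 1 powr (\<beta> + \<delta> - 1) * \<tau> powr (\<beta> + \<delta> - 1)"
    using assms by (simp add: powr_mult)
  finally show ?thesis .
qed

lemma beta_integrand_bound:
  assumes "profile \<beta> \<delta> K g" "t > 0"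
  shows "beta_kernel \<beta> \<tau> * g (t * \<tau>) \<le>
           K * min t 1 powr (\<beta> + \<delta> - 1) * (beta_kernel \<beta> \<tau> * \<tau> powr (\<beta> + \<delta> - 1))"
proof (cases "\<tau> \<in> {0<..<1}")
  case True
  then have "beta_kernel \<beta> \<tau> * g (t * \<tau>) \<le>
      beta_kernel \<beta> \<tau> * (K * min t 1 powr (\<beta> + \<delta> - 1) * \<tau> powr (\<beta> + \<delta> - 1))"
    using profile_scaled_bound[OF assms, of \<tau>] by (intro mult_left_mono beta_kernel_nonneg) auto
  then show ?thesis by (simp add: mult_ac)
qed (simp add: beta_kernel_def)

lemma beta_integrand_nonneg:
  assumes "profile \<beta> \<delta> K g" "t > 0"
  shows "0 \<le> beta_kernel \<beta> \<tau> * g (t * \<tau>)"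
  using assms beta_kernel_nonneg[of \<beta> \<tau>]
  by (cases "\<tau> \<in> {0<..<1}") (auto simp: profile_def beta_kernel_def)

lemma beta_integrand_integrable:
  assumes "0 < \<beta>" "0 < \<delta>" "profile \<beta> \<delta> K g" "t > 0"
  shows "integrable lborel (\<lambda>\<tau>. beta_kernel \<beta> \<tau> * g (t * \<tau>))"
proof (rule Bochner_Integration.integrable_bound)
  show "integrable lborel (\<lambda>\<tau>. K * min t 1 powr (\<beta> + \<delta> - 1) *
          (beta_kernel \<beta> \<tau> * \<tau> powr (\<beta> + \<delta> - 1)))"
    using beta_kernel_powr_integral[OF assms(1,2)]
    by (intro integrable_mult_right) (simp add: has_bochner_integral_iff)
  show "(\<lambda>\<tau>. beta_kernel \<beta> \<tau> * g (t * \<tau>)) \<in> borel_measurable lborel"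
    using beta_integrand_measurable assms(3,4) by (simp add: profile_def)
  show "AE \<tau> in lborel. norm (beta_kernel \<beta> \<tau> * g (t * \<tau>)) \<le>
      norm (K * min t 1 powr (\<beta> + \<delta> - 1) * (beta_kernel \<beta> \<tau> * \<tau> powr (\<beta> + \<delta> - 1)))"
    using beta_integrand_bound[OF assms(3,4)] beta_integrand_nonneg[OF assms(3,4)]
    by (intro AE_I2) (smt (verit) real_norm_def)
qed

lemma beta_avg_nonneg:
  assumes "profile \<beta> \<delta> K g" "t > 0"
  shows "0 \<le> beta_avg \<beta> g t"
  unfolding beta_avg_def by (intro Bochner_Integration.integral_nonneg beta_integrand_nonneg[OF assms])

lemma beta_avg_bound:
  assumes "0 < \<beta>" "0 < \<delta>" "profile \<beta> \<delta> K g" "t > 0"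
  shows "beta_avg \<beta> g t \<le> K * min t 1 powr (\<beta> + \<delta> - 1) * Beta \<delta> \<beta>"
proof -
  have B: "integrable lborel (\<lambda>\<tau>. beta_kernel \<beta> \<tau> * \<tau> powr (\<beta> + \<delta> - 1))"
          "(\<integral>\<tau>. beta_kernel \<beta> \<tau> * \<tau> powr (\<beta> + \<delta> - 1) \<partial>lborel) = Beta \<delta> \<beta>"
    using beta_kernel_powr_integral[OF assms(1,2)] by (auto simp: has_bochner_integral_iff)
  have "beta_avg \<beta> g t \<le> (\<integral>\<tau>. K * min t 1 powr (\<beta> + \<delta> - 1) *
          (beta_kernel \<beta> \<tau> * \<tau> powr (\<beta> + \<delta> - 1)) \<partial>lborel)"
    unfolding beta_avg_def
    using beta_integrand_integrable[OF assms] B(1) beta_integrand_bound[OF assms(3,4)]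
    by (intro integral_mono integrable_mult_right) auto
  also have "\<dots> = K * min t 1 powr (\<beta> + \<delta> - 1) * Beta \<delta> \<beta>"
    using B by simp
  finally show ?thesis .
qed

lemma beta_avg_mono:
  assumes "0 < \<beta>" "0 < \<delta>" "profile \<beta> \<delta> K g" "profile \<beta> \<delta> K' h" "t > 0"
    and "\<And>s. s > 0 \<Longrightarrow> g s \<le> h s"
  shows "beta_avg \<beta> g t \<le> beta_avg \<beta> h t"
  unfolding beta_avg_def
proof (intro integral_mono beta_integrand_integrable[OF assms(1,2,3,5)]
    beta_integrand_integrable[OF assms(1,2,4,5)])
  show "beta_kernel \<beta> \<tau> * g (t * \<tau>) \<le> beta_kernel \<beta> \<tau> * h (t * \<tau>)" for \<tau>
    using assms(5,6) by (cases "\<tau> \<in> {0<..<1}")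
      (auto simp: beta_kernel_def intro!: mult_left_mono)
qed

lemma beta_integrand_antimono:
  assumes "antimono_on {0<..} g" "0 < s" "s \<le> t"
  shows "beta_kernel \<beta> \<tau> * g (t * \<tau>) \<le> beta_kernel \<beta> \<tau> * g (s * \<tau>)"
  using assms by (cases "\<tau> \<in> {0<..<1}")
    (auto simp: beta_kernel_def monotone_on_def intro!: mult_left_mono)

lemma beta_avg_antimono:
  assumes "0 < \<beta>" "0 < \<delta>" "profile \<beta> \<delta> K g"
  shows "antimono_on {0<..} (beta_avg \<beta> g)"
proof (rule monotone_onI)
  fix s t :: real assume "s \<in> {0<..}" "t \<in> {0<..}" "s \<le> t"
  then show "beta_avg \<beta> g t \<le> beta_avg \<beta> g s"
    using assms(3) unfolding beta_avg_def
    by (intro integral_mono beta_integrand_antimono beta_integrand_integrable[OF assms])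
       (auto simp: profile_def)
qed

text \<open>Dominated convergence: for $t \ge 1$ the integrand is at most its value at $t = 1$.\<close>

lemma beta_avg_at_top:
  assumes "0 < \<beta>" "\<beta> < 1" "0 < \<delta>" "profile \<beta> \<delta> K g" and lim: "(g \<longlongrightarrow> c) at_top"
  shows "(beta_avg \<beta> g \<longlongrightarrow> Beta (1 - \<beta>) \<beta> * c) at_top"
proof -
  have am: "antimono_on {0<..} g" using assms by (simp add: profile_def)
  \<comment> \<open>Clamping \<open>t\<close> at \<open>1\<close> keeps the integrand measurable for every \<open>t\<close>, also for \<open>t \<le> 0\<close>.\<close>
  let ?s = "\<lambda>t \<tau>. beta_kernel \<beta> \<tau> * g (max t 1 * \<tau>)"
  have "((\<lambda>t. integral\<^sup>L lborel (?s t)) \<longlongrightarrow> (\<integral>\<tau>. beta_kernel \<beta> \<tau> * c \<partial>lborel)) at_top"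
  proof (rule integral_dominated_convergence_at_top)
    show "(\<lambda>\<tau>. beta_kernel \<beta> \<tau> * c) \<in> borel_measurable lborel" by simp
    show "?s t \<in> borel_measurable lborel" for t
      using beta_integrand_measurable[OF am, of "max t 1"] by simp
    show "integrable lborel (\<lambda>\<tau>. beta_kernel \<beta> \<tau> * g (1 * \<tau>))"
      by (rule beta_integrand_integrable[OF assms(1,3,4)]) simp
    show "AE \<tau> in lborel. ((\<lambda>t. ?s t \<tau>) \<longlongrightarrow> beta_kernel \<beta> \<tau> * c) at_top"
    proof (intro AE_I2)
      fix \<tau> :: real
      show "((\<lambda>t. ?s t \<tau>) \<longlongrightarrow> beta_kernel \<beta> \<tau> * c) at_top"
      proof (cases "\<tau> \<in> {0<..<1}")
        case True
        have "filterlim (\<lambda>t. \<tau> * t) at_top at_top"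
          using True by (intro filterlim_tendsto_pos_mult_at_top[OF tendsto_const]) (auto intro: filterlim_ident)
        then have "((\<lambda>t. g (\<tau> * t)) \<longlongrightarrow> c) at_top"
          by (rule filterlim_compose[OF lim])
        moreover have "\<forall>\<^sub>F t in at_top. g (\<tau> * t) = g (max t 1 * \<tau>)"
          using eventually_ge_at_top[of 1] by eventually_elim (simp add: max_def mult.commute)
        ultimately have "((\<lambda>t. g (max t 1 * \<tau>)) \<longlongrightarrow> c) at_top"
          by (rule Lim_transform_eventually)
        then show ?thesis by (rule tendsto_mult_left)
      qed (simp add: beta_kernel_def)
    qed
    show "\<forall>\<^sub>F t in at_top. AE \<tau> in lborel. norm (?s t \<tau>) \<le> beta_kernel \<beta> \<tau> * g (1 * \<tau>)"
      using beta_integrand_antimono[OF am, of 1] beta_integrand_nonneg[OF assms(4)]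
      by (intro always_eventually allI AE_I2) simp
  qed
  moreover have "(\<integral>\<tau>. beta_kernel \<beta> \<tau> * c \<partial>lborel) = Beta (1 - \<beta>) \<beta> * c"
    using beta_kernel_integral[OF assms(1,2)] by (simp add: has_bochner_integral_iff)
  moreover have "\<forall>\<^sub>F t in at_top. integral\<^sup>L lborel (?s t) = beta_avg \<beta> g t"
    using eventually_ge_at_top[of 1] by eventually_elim (simp add: max_def beta_avg_def)
  ultimately show ?thesis
    using Lim_transform_eventually by fastforce
qed

text \<open>A fixed point is at first known only to be monotone, so its continuity has to come from averaging
a possibly discontinuous $g$. A monotone function has countably many discontinuities, so for fixed
$a > 0$ almost every $\tau$ has $g$ continuous at $a\tau$. Dominated convergence, with the integrand at
$a/2$ bounding those at all $t > a/2$, gives continuity at $a$.\<close>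

lemma beta_avg_continuous:
  assumes "0 < \<beta>" "0 < \<delta>" "profile \<beta> \<delta> K g"
  shows "continuous_on {0<..} (beta_avg \<beta> g)"
  unfolding continuous_on_sequentially
proof (intro allI ballI impI)
  fix x :: "nat \<Rightarrow> real" and a :: real
  assume a: "a \<in> {0<..}" and x: "(\<forall>n. x n \<in> {0<..}) \<and> x \<longlonglongrightarrow> a"
  have am: "antimono_on {0<..} g" using assms by (simp add: profile_def)
  have "\<forall>\<^sub>F n in sequentially. a / 2 < x n"
    using x a by (intro order_tendstoD(1)[of _ a]) auto
  then obtain N where N: "\<And>n. n \<ge> N \<Longrightarrow> a / 2 < x n"
    by (auto simp: eventually_sequentially)
  \<comment> \<open>The null set to avoid is the set of discontinuities of \<open>g\<close>, scaled back by \<open>a\<close>.\<close>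
  define D where "D = {s \<in> {0<..}. \<not> isCont (\<lambda>s. - g s) s}"
  have "countable D"
    unfolding D_def using am
    by (intro mono_on_ctble_discont_open) (auto simp: monotone_on_def)
  then have "countable ((\<lambda>s. s / a) ` D)" by simp
  then have null: "(\<lambda>s. s / a) ` D \<in> null_sets lborel"
    by (rule countable_imp_null_set_lborel)
  have "(\<lambda>n. \<integral>\<tau>. beta_kernel \<beta> \<tau> * g (x (n + N) * \<tau>) \<partial>lborel)
          \<longlonglongrightarrow> (\<integral>\<tau>. beta_kernel \<beta> \<tau> * g (a * \<tau>) \<partial>lborel)"
  proof (rule integral_dominated_convergence)
    show "(\<lambda>\<tau>. beta_kernel \<beta> \<tau> * g (a * \<tau>)) \<in> borel_measurable lborel"
      using beta_integrand_measurable[OF am] a by simp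
    show "(\<lambda>\<tau>. beta_kernel \<beta> \<tau> * g (x (n + N) * \<tau>)) \<in> borel_measurable lborel" for n
      using beta_integrand_measurable[OF am] x by simp
    show "integrable lborel (\<lambda>\<tau>. beta_kernel \<beta> \<tau> * g (a / 2 * \<tau>))"
      by (rule beta_integrand_integrable[OF assms]) (use a in simp)
    show "AE \<tau> in lborel. norm (beta_kernel \<beta> \<tau> * g (x (n + N) * \<tau>)) \<le> beta_kernel \<beta> \<tau> * g (a / 2 * \<tau>)" for n
      using beta_integrand_antimono[OF am, of "a/2" "x (n + N)"]
        beta_integrand_nonneg[OF assms(3), of "x (n + N)"] N[of "n + N"] x a
      by (intro AE_I2) auto
    have "AE \<tau> in lborel. \<tau> \<notin> (\<lambda>s. s / a) ` D"
      using null by (rule AE_not_in)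
    then show "AE \<tau> in lborel. (\<lambda>n. beta_kernel \<beta> \<tau> * g (x (n + N) * \<tau>))
                 \<longlonglongrightarrow> beta_kernel \<beta> \<tau> * g (a * \<tau>)"
    proof eventually_elim
      case (elim \<tau>)
      show ?case
      proof (cases "\<tau> \<in> {0<..<1}")
        case True
        have "a * \<tau> \<notin> D"
          using elim a by (auto simp: image_iff)
        then have "isCont (\<lambda>s. - g s) (a * \<tau>)"
          using True a by (auto simp: D_def)
        then have "isCont g (a * \<tau>)"
          using continuous_minus[of "at (a * \<tau>)" "\<lambda>s. - g s"] by simp
        moreover have "(\<lambda>n. x (n + N) * \<tau>) \<longlonglongrightarrow> a * \<tau>"
          using x by (intro tendsto_mult_right LIMSEQ_ignore_initial_segment) auto
        ultimately have "(\<lambda>n. g (x (n + N) * \<tau>)) \<longlonglongrightarrow> g (a * \<tau>)"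
          by (rule isCont_tendsto_compose)
        then show ?thesis by (rule tendsto_mult_left)
      qed (simp add: beta_kernel_def)
    qed
  qed
  then have "(\<lambda>n. beta_avg \<beta> g (x (n + N))) \<longlonglongrightarrow> beta_avg \<beta> g a"
    unfolding beta_avg_def .
  then show "(beta_avg \<beta> g \<circ> x) \<longlonglongrightarrow> beta_avg \<beta> g a"
    unfolding o_def by (rule LIMSEQ_offset)
qed

lemma profile_const_nonneg:
  assumes "profile \<beta> \<delta> K g"
  shows "0 \<le> K"
proof -
  have "0 \<le> g 1" "g 1 \<le> K * 1 powr (\<beta> + \<delta> - 1)"
    using assms unfolding profile_def by (blast intro: zero_less_one order_refl)+
  then show ?thesis by simp
qed

text \<open>This is not an instance of monotonicity in $g$: a constant need not satisfy the bound near $0$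
that a profile has to satisfy, since $\beta + \delta - 1$ may be positive.\<close>

lemma beta_avg_lower_bound:
  assumes "0 < \<beta>" "\<beta> < 1" "0 < \<delta>" "profile \<beta> \<delta> K g" "t > 0" "\<And>s. s > 0 \<Longrightarrow> c \<le> g s"
  shows "Beta (1 - \<beta>) \<beta> * c \<le> beta_avg \<beta> g t"
proof -
  have "Beta (1 - \<beta>) \<beta> * c = (\<integral>\<tau>. beta_kernel \<beta> \<tau> * c \<partial>lborel)"
    using beta_kernel_integral[OF assms(1,2)] by (simp add: has_bochner_integral_iff)
  also have "\<dots> \<le> beta_avg \<beta> g t"
    unfolding beta_avg_def
  proof (intro integral_mono beta_integrand_integrable[OF assms(1,3,4,5)])
    show "integrable lborel (\<lambda>\<tau>. beta_kernel \<beta> \<tau> * c)"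
      using beta_kernel_integral[OF assms(1,2)] by (simp add: has_bochner_integral_iff)
    show "beta_kernel \<beta> \<tau> * c \<le> beta_kernel \<beta> \<tau> * g (t * \<tau>)" for \<tau>
      using assms(5,6) by (cases "\<tau> \<in> {0<..<1}")
        (auto simp: beta_kernel_def intro!: mult_left_mono)
  qed
  finally show ?thesis .
qed

section \<open>Primitives of integrable functions\<close>

lemma indefinite_integral_diff:
  fixes f :: "real \<Rightarrow> real"
  assumes f: "\<And>t. integrable lborel (\<lambda>s. indicator {0<..<t} s * f s)" and "0 < u" "u \<le> v"
  shows "integrable lborel (\<lambda>s. indicator {u..<v} s * f s)"
    and "(\<integral>s. indicator {0<..<v} s * f s \<partial>lborel) - (\<integral>s. indicator {0<..<u} s * f s \<partial>lborel)
      = (\<integral>s. indicator {u..<v} s * f s \<partial>lborel)"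
proof -
  have eq: "(\<lambda>s. indicator {u..<v} s * f s) =
     (\<lambda>s. indicator {0<..<v} s * f s - indicator {0<..<u} s * f s)"
    using assms by (auto simp: indicator_def fun_eq_iff)
  show "integrable lborel (\<lambda>s. indicator {u..<v} s * f s)"
    unfolding eq by (intro Bochner_Integration.integrable_diff f)
  show "(\<integral>s. indicator {0<..<v} s * f s \<partial>lborel) - (\<integral>s. indicator {0<..<u} s * f s \<partial>lborel)
      = (\<integral>s. indicator {u..<v} s * f s \<partial>lborel)"
    unfolding eq by (intro Bochner_Integration.integral_diff[symmetric] f)
qed

lemma indefinite_integral_has_derivative:
  fixes f :: "real \<Rightarrow> real"
  assumes f: "\<And>t. integrable lborel (\<lambda>s. indicator {0<..<t} s * f s)"
    and cont: "continuous_on {0<..} f" and "t > 0"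
  shows "((\<lambda>t. \<integral>s. indicator {0<..<t} s * f s \<partial>lborel) has_real_derivative f t) (at t)"
proof -
  let ?F = "\<lambda>t. \<integral>s. indicator {0<..<t} s * f s \<partial>lborel"
  have eq: "?F (t / 2) + integral {t / 2..u} f = ?F u" if "u \<in> {t/2<..<2*t}" for u
  proof -
    have c: "continuous_on {t/2..u} f"
      using \<open>t > 0\<close> by (intro continuous_on_subset[OF cont]) auto
    have "?F u - ?F (t / 2) = (\<integral>s. indicator {t/2..<u} s * f s \<partial>lborel)"
      using that \<open>t > 0\<close> by (intro indefinite_integral_diff f) auto
    also have "\<dots> = (LINT s:{t/2..u}|lborel. f s)"
      unfolding set_lebesgue_integral_def
    proof (rule integral_cong_AE)
      show "(\<lambda>s. indicator {t/2..<u} s * f s) \<in> borel_measurable lborel"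
        using indefinite_integral_diff(1)[OF f, of "t/2" u] that \<open>t > 0\<close> by auto
      show "(\<lambda>s. indicator {t/2..u} s *\<^sub>R f s) \<in> borel_measurable lborel"
        using borel_measurable_continuous_on_indicator[OF _ c] by simp
      show "AE s in lborel. indicator {t/2..<u} s * f s = indicator {t/2..u} s *\<^sub>R f s"
        using AE_lborel_singleton[of u] by eventually_elim (auto simp: indicator_def)
    qed
    also have "\<dots> = integral {t/2..u} f"
      by (intro set_borel_integral_eq_integral borel_integrable_atLeastAtMost' c)
    finally show ?thesis by simp
  qed
  have "continuous_on {t/2..2*t} f"
    using \<open>t > 0\<close> by (intro continuous_on_subset[OF cont]) auto
  then have "((\<lambda>u. integral {t/2..u} f) has_real_derivative f t) (at t within {t/2..2*t})"
    using \<open>t > 0\<close> by (intro integral_has_real_derivative) auto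
  moreover have "at t within {t/2..2*t} = at t"
    using \<open>t > 0\<close> by (intro at_within_interior) (auto simp: interior_atLeastAtMost_real)
  ultimately have "((\<lambda>u. ?F (t / 2) + integral {t/2..u} f) has_real_derivative f t) (at t)"
    by (auto intro!: derivative_eq_intros)
  then show ?thesis
    by (rule has_field_derivative_transform_within_open[where S = "{t/2<..<2*t}"]) (use \<open>t > 0\<close> eq in auto)
qed

text \<open>Half-open intervals make increments of a primitive exact, without exceptional null sets. A common
point of two of them is the left end of an open interval contained in both interiors.\<close>

lemma disjoint_half_open_intervals:
  fixes u v :: "nat \<Rightarrow> real"
  assumes "{u i<..<v i} \<inter> {u j<..<v j} = {}"
  shows "{u i..<v i} \<inter> {u j..<v j} = {}"
proof (rule ccontr)
  assume "\<not> ?thesis"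
  then obtain z where z: "u i \<le> z" "z < v i" "u j \<le> z" "z < v j"
    unfolding disjoint_iff by (auto simp only: atLeastLessThan_iff)
  then obtain y where "z < y" "y < min (v i) (v j)"
    using dense[of z "min (v i) (v j)"] by auto
  with z have "y \<in> {u i<..<v i} \<inter> {u j<..<v j}" by auto
  with assms show False by simp
qed

text \<open>The part of an integrable function above the level $N$ tends to $0$ in the mean. This splits
the function into a bounded part and a part with small integral, the usual route to absolute
continuity of its primitive.\<close>

lemma truncation_error_small:
  fixes f :: "real \<Rightarrow> real"
  assumes "integrable M f" "\<And>s. 0 \<le> f s" "\<epsilon> > 0"
  obtains N :: nat where "(\<integral>s. f s - min (f s) (real N) \<partial>M) < \<epsilon>"
proof -
  have [measurable]: "f \<in> borel_measurable M" using assms(1) by auto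
  have "(\<lambda>N. \<integral>s. f s - min (f s) (real N) \<partial>M) \<longlonglongrightarrow> (\<integral>s. 0 \<partial>M)"
  proof (rule integral_dominated_convergence[where w = f])
    show "AE s in M. (\<lambda>N. f s - min (f s) (real N)) \<longlonglongrightarrow> 0"
    proof (intro AE_I2 tendsto_eventually)
      fix s
      obtain N0 :: nat where "f s \<le> real N0" using real_arch_simple by blast
      then show "\<forall>\<^sub>F N in sequentially. f s - min (f s) (real N) = 0"
        by (intro eventually_sequentiallyI[of N0]) auto
    qed
  qed (use assms in auto)
  then have "\<forall>\<^sub>F N in sequentially. (\<integral>s. f s - min (f s) (real N) \<partial>M) < \<epsilon>"
    using assms(3) by (intro order_tendstoD(2)[where y = 0]) auto
  then show ?thesis using that by (auto simp: eventually_sequentially)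
qed

lemma indefinite_integral_abs_continuous:
  fixes f :: "real \<Rightarrow> real"
  assumes f: "\<And>t. integrable lborel (\<lambda>s. indicator {0<..<t} s * f s)"
    and nn: "\<And>s. s > 0 \<Longrightarrow> 0 \<le> f s"
  shows "abs_continuous_on {0<..T} (\<lambda>t. \<integral>s. indicator {0<..<t} s * f s \<partial>lborel)"
  unfolding abs_continuous_on_def
proof (intro allI impI)
  fix \<epsilon> :: real assume "\<epsilon> > 0"
  let ?F = "\<lambda>t. \<integral>s. indicator {0<..<t} s * f s \<partial>lborel"
  define h where "h = (\<lambda>s. indicator {0<..<T} s * f s)"
  have hi: "integrable lborel h" unfolding h_def by (rule f)
  have h0: "0 \<le> h s" for s using nn[of s] by (auto simp: h_def indicator_def)
  obtain N :: nat where N: "(\<integral>s. h s - min (h s) (real N) \<partial>lborel) < \<epsilon> / 2"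
    using truncation_error_small[OF hi h0, of "\<epsilon> / 2"] \<open>\<epsilon> > 0\<close> by auto
  define e where "e = (\<lambda>s. h s - min (h s) (real N))"
  have ei: "integrable lborel e"
    unfolding e_def by (rule Bochner_Integration.integrable_bound[OF hi]) (use hi h0 in auto)
  have e0: "0 \<le> e s" for s by (simp add: e_def)
  have ind_i: "integrable lborel (\<lambda>s. indicator {a..<b} s * e s)" for a b
    using integrable_mult_indicator[OF _ ei, of "{a..<b}"] by simp
  have "(\<Sum>i<n. \<bar>?F (v i) - ?F (u i)\<bar>) < \<epsilon>"
    if uv: "\<And>i. i < n \<Longrightarrow> u i \<le> v i \<and> {u i..v i} \<subseteq> {0<..T}"
      and disj: "\<And>i j. i < n \<Longrightarrow> j < n \<Longrightarrow> i \<noteq> j \<Longrightarrow> {u i<..<v i} \<inter> {u j<..<v j} = {}"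
      and len: "(\<Sum>i<n. v i - u i) < \<epsilon> / (2 * (real N + 1))" for n :: nat and u v
  proof -
    have each: "\<bar>?F (v i) - ?F (u i)\<bar> \<le>
        real N * (v i - u i) + (\<integral>s. indicator {u i..<v i} s * e s \<partial>lborel)" if "i < n" for i
    proof -
      have *: "0 < u i" "u i \<le> v i" "v i \<le> T" using uv[OF that] by auto
      note d = indefinite_integral_diff[OF f *(1,2)]
      have le: "indicator {u i..<v i} s * f s \<le>
          real N * indicator {u i..<v i} s + indicator {u i..<v i} s * e s" for s
        using * by (auto simp: indicator_def e_def h_def)
      have "?F (v i) - ?F (u i) \<le> (\<integral>s. real N * indicator {u i..<v i} s + indicator {u i..<v i} s * e s \<partial>lborel)"
        unfolding d(2) using ind_i le d(1) *
        by (intro integral_mono Bochner_Integration.integrable_add integrable_mult_right) auto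
      also have "\<dots> = real N * (v i - u i) + (\<integral>s. indicator {u i..<v i} s * e s \<partial>lborel)"
        using ind_i * by (subst Bochner_Integration.integral_add) auto
      finally have "?F (v i) - ?F (u i) \<le>
         real N * (v i - u i) + (\<integral>s. indicator {u i..<v i} s * e s \<partial>lborel)" .
      moreover have "0 \<le> ?F (v i) - ?F (u i)"
        unfolding d(2) using * nn by (intro Bochner_Integration.integral_nonneg) (auto simp: indicator_def)
      ultimately show ?thesis by simp
    qed
    have df: "disjoint_family_on (\<lambda>i. {u i..<v i}) {..<n}"
      unfolding disjoint_family_on_def using disj by (auto intro!: disjoint_half_open_intervals)
    have "(\<Sum>i<n. \<integral>s. indicator {u i..<v i} s * e s \<partial>lborel) =
        (\<integral>s. (\<Sum>i<n. indicator {u i..<v i} s) * e s \<partial>lborel)"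
      unfolding sum_distrib_right by (intro Bochner_Integration.integral_sum[symmetric] ind_i)
    also have "\<dots> = (\<integral>s. indicator (\<Union>i<n. {u i..<v i}) s * e s \<partial>lborel)"
      by (simp add: indicator_UN_disjoint[OF _ df])
    also have "\<dots> \<le> (\<integral>s. e s \<partial>lborel)"
      using integrable_mult_indicator[OF _ ei, of "\<Union>i<n. {u i..<v i}"] ei e0
      by (intro integral_mono) (auto simp: indicator_def)
    finally have tail: "(\<Sum>i<n. \<integral>s. indicator {u i..<v i} s * e s \<partial>lborel) < \<epsilon> / 2"
      using N by (simp add: e_def)
    have "real N * (\<Sum>i<n. v i - u i) \<le> (real N + 1) * (\<Sum>i<n. v i - u i)"
      using uv by (intro mult_right_mono sum_nonneg) auto
    also have "\<dots> < \<epsilon> / 2"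
      using len by (simp add: field_simps)
    finally have main: "real N * (\<Sum>i<n. v i - u i) < \<epsilon> / 2" .
    have "(\<Sum>i<n. \<bar>?F (v i) - ?F (u i)\<bar>) \<le>
       (\<Sum>i<n. real N * (v i - u i) + (\<integral>s. indicator {u i..<v i} s * e s \<partial>lborel))"
      by (intro sum_mono each) auto
    also have "\<dots> = real N * (\<Sum>i<n. v i - u i) + (\<Sum>i<n. \<integral>s. indicator {u i..<v i} s * e s \<partial>lborel)"
      by (simp add: sum.distrib sum_distrib_left)
    also have "\<dots> < \<epsilon>" using main tail by linarith
    finally show ?thesis .
  qed
  then show "\<exists>\<delta>>0. \<forall>(n::nat) u v.
        (\<forall>i<n. u i \<le> v i \<and> {u i..v i} \<subseteq> {0<..T}) \<and>
        (\<forall>i<n. \<forall>j<n. i \<noteq> j \<longrightarrow> {u i<..<v i} \<inter> {u j<..<v j} = {}) \<and>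
        (\<Sum>i<n. v i - u i) < \<delta> \<longrightarrow>
        (\<Sum>i<n. \<bar>?F (v i) - ?F (u i)\<bar>) < \<epsilon>"
    \<comment> \<open>\<open>N + 1\<close> rather than \<open>N\<close>, as the truncation level may be \<open>0\<close>.\<close>
    using \<open>\<epsilon> > 0\<close> by (intro exI[of _ "\<epsilon> / (2 * (real N + 1))"]) auto
qed

lemma abs_continuous_on_add_const:
  assumes "abs_continuous_on S F" "\<And>t. t \<in> S \<Longrightarrow> G t = c + F t"
  shows "abs_continuous_on S G"
proof -
  have eq: "(\<Sum>i<n. \<bar>G (v i) - G (u i)\<bar>) = (\<Sum>i<n. \<bar>F (v i) - F (u i)\<bar>)"
    if "\<forall>i<n. u i \<le> v i \<and> {u i..v i} \<subseteq> S" for n :: nat and u v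
  proof (intro sum.cong refl)
    fix i assume "i \<in> {..<n}"
    then have "u i \<in> {u i..v i}" "v i \<in> {u i..v i}" "{u i..v i} \<subseteq> S" using that by auto
    then have "u i \<in> S" "v i \<in> S" by blast+
    then show "\<bar>G (v i) - G (u i)\<bar> = \<bar>F (v i) - F (u i)\<bar>" using assms(2) by simp
  qed
  show ?thesis
    unfolding abs_continuous_on_def
  proof (intro allI impI)
    fix \<epsilon> :: real assume "\<epsilon> > 0"
    then obtain d where "d > 0" and d: "\<And>(n::nat) u v.
        (\<forall>i<n. u i \<le> v i \<and> {u i..v i} \<subseteq> S) \<and>
        (\<forall>i<n. \<forall>j<n. i \<noteq> j \<longrightarrow> {u i<..<v i} \<inter> {u j<..<v j} = {}) \<and>
        (\<Sum>i<n. v i - u i) < d \<Longrightarrow> (\<Sum>i<n. \<bar>F (v i) - F (u i)\<bar>) < \<epsilon>"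
      using assms(1) unfolding abs_continuous_on_def by blast
    show "\<exists>\<delta>>0. \<forall>(n::nat) u v.
        (\<forall>i<n. u i \<le> v i \<and> {u i..v i} \<subseteq> S) \<and>
        (\<forall>i<n. \<forall>j<n. i \<noteq> j \<longrightarrow> {u i<..<v i} \<inter> {u j<..<v j} = {}) \<and>
        (\<Sum>i<n. v i - u i) < \<delta> \<longrightarrow> (\<Sum>i<n. \<bar>G (v i) - G (u i)\<bar>) < \<epsilon>"
    proof (intro exI[of _ d] conjI allI impI \<open>d > 0\<close>)
      fix n :: nat and u v :: "nat \<Rightarrow> real"
      assume fam: "(\<forall>i<n. u i \<le> v i \<and> {u i..v i} \<subseteq> S) \<and>
        (\<forall>i<n. \<forall>j<n. i \<noteq> j \<longrightarrow> {u i<..<v i} \<inter> {u j<..<v j} = {}) \<and>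
        (\<Sum>i<n. v i - u i) < d"
      then show "(\<Sum>i<n. \<bar>G (v i) - G (u i)\<bar>) < \<epsilon>"
        using d[OF fam] eq by simp
    qed
  qed
qed

section \<open>From the Volterra equation to the fractional differential equation\<close>

text \<open>The kernels of the fractional integrals of orders $1-\beta$ and $\beta$ compose to a constant; by
the substitution $s = r + (t-r)\sigma$ all powers of $t-r$ cancel.\<close>

lemma nn_integral_beta_kernel_shifted:
  assumes "0 < \<beta>" "\<beta> < 1" "r < t"
  shows "(\<integral>\<^sup>+s. ennreal (indicator {r<..<t} s * ((t - s) powr (-\<beta>) * (s - r) powr (\<beta> - 1))) \<partial>lborel)
         = ennreal (Beta \<beta> (1 - \<beta>))"
proof -
  have "(\<integral>\<^sup>+s. ennreal (indicator {r<..<t} s * ((t - s) powr (-\<beta>) * (s - r) powr (\<beta> - 1))) \<partial>lborel)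
     = \<bar>t - r\<bar> * (\<integral>\<^sup>+\<sigma>. ennreal (indicator {r<..<t} (r + (t - r) * \<sigma>) *
          ((t - (r + (t - r) * \<sigma>)) powr (-\<beta>) * ((r + (t - r) * \<sigma>) - r) powr (\<beta> - 1))) \<partial>lborel)"
    using assms by (intro nn_integral_real_affine) auto
  also have "\<dots> = (\<integral>\<^sup>+\<sigma>. \<bar>t - r\<bar> * ennreal (indicator {r<..<t} (r + (t - r) * \<sigma>) *
          ((t - (r + (t - r) * \<sigma>)) powr (-\<beta>) * ((r + (t - r) * \<sigma>) - r) powr (\<beta> - 1))) \<partial>lborel)"
    by (subst nn_integral_cmult) auto
  also have "\<dots> = (\<integral>\<^sup>+\<sigma>. ennreal (indicator {0<..<1} \<sigma> * (\<sigma> powr (\<beta> - 1) * (1 - \<sigma>) powr ((1 - \<beta>) - 1))) \<partial>lborel)"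
  proof (intro nn_integral_cong)
    fix \<sigma> :: real
    have ind: "indicat_real {r<..<t} (r + (t - r) * \<sigma>) = indicator {0<..<1} \<sigma>"
    proof -
      have "r + (t - r) * \<sigma> < t \<longleftrightarrow> (t - r) * \<sigma> < (t - r) * 1" by (simp add: algebra_simps)
      also have "\<dots> \<longleftrightarrow> \<sigma> < 1" using assms by (subst mult_less_cancel_left_pos) auto
      finally show ?thesis using assms by (auto simp: indicator_def zero_less_mult_iff)
    qed
    show "\<bar>t - r\<bar> * ennreal (indicator {r<..<t} (r + (t - r) * \<sigma>) *
          ((t - (r + (t - r) * \<sigma>)) powr (-\<beta>) * ((r + (t - r) * \<sigma>) - r) powr (\<beta> - 1))) =
       ennreal (indicator {0<..<1} \<sigma> * (\<sigma> powr (\<beta> - 1) * (1 - \<sigma>) powr ((1 - \<beta>) - 1)))"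
    proof (cases "\<sigma> \<in> {0<..<1}")
      case True
      have 1: "t - (r + (t - r) * \<sigma>) = (t - r) * (1 - \<sigma>)" by (simp add: algebra_simps)
      have "(t - r) * (((t - r) * (1 - \<sigma>)) powr (-\<beta>) * ((t - r) * \<sigma>) powr (\<beta> - 1)) =
         ((t - r) powr 1 * (t - r) powr (-\<beta>) * (t - r) powr (\<beta> - 1)) * (\<sigma> powr (\<beta> - 1) * (1 - \<sigma>) powr (-\<beta>))"
        using True assms by (simp add: powr_mult)
      also have "(t - r) powr 1 * (t - r) powr (-\<beta>) * (t - r) powr (\<beta> - 1) = 1"
        using assms by (simp only: powr_add[symmetric]) simp
      finally show ?thesis using True assms unfolding ind 1 by (simp flip: ennreal_mult')
    qed (simp add: ind)
  qed
  also have "\<dots> = ennreal (Beta \<beta> (1 - \<beta>))"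
    using has_bochner_integral_Beta[of \<beta> "1 - \<beta>"] assms
    by (subst nn_integral_eq_integral) (auto simp: has_bochner_integral_iff)
  finally show ?thesis .
qed

lemma powr_mult_antimono_measurable:
  fixes g :: "real \<Rightarrow> real"
  assumes "antimono_on {0<..} g"
  shows "(\<lambda>s. indicator {0<..<t} s * (s powr (-\<beta>) * g s)) \<in> borel_measurable borel"
proof -
  note [measurable] = antimono_on_measurable[OF assms]
  have "(\<lambda>s. indicator {0<..<t} s * (s powr (-\<beta>) * g s)) =
     (\<lambda>s. indicator {0<..<t} s * (s powr (-\<beta>) * (indicator {0<..} s * g s)))"
    by (auto simp: indicator_def)
  also have "\<dots> \<in> borel_measurable borel" by measurable
  finally show ?thesis .
qed

text \<open>The substitution $r = t\tau$; the powers of $t$ cancel because of the weight $r^{-\beta}$.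
The left-hand side is $\Gamma(\beta)$ times the fractional integral of order $\beta$ of $r^{-\beta} g(r)$.\<close>

lemma nn_integral_fractional_eq_beta_avg:
  assumes "0 < \<beta>" "0 < \<delta>" "profile \<beta> \<delta> K g" "t > 0"
  shows "(\<integral>\<^sup>+r. ennreal ((t - r) powr (\<beta> - 1) * (indicator {0<..<t} r * (r powr (-\<beta>) * g r))) \<partial>lborel)
         = ennreal (beta_avg \<beta> g t)"
proof -
  have am: "antimono_on {0<..} g" using assms by (simp add: profile_def)
  note [measurable] = powr_mult_antimono_measurable[OF am]
  let ?f = "\<lambda>r. (t - r) powr (\<beta> - 1) * (indicator {0<..<t} r * (r powr (-\<beta>) * g r))"
  have "(\<integral>\<^sup>+r. ennreal (?f r) \<partial>lborel) = \<bar>t\<bar> * (\<integral>\<^sup>+\<tau>. ennreal (?f (0 + t * \<tau>)) \<partial>lborel)"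
    using assms by (intro nn_integral_real_affine) auto
  also have "\<dots> = (\<integral>\<^sup>+\<tau>. \<bar>t\<bar> * ennreal (?f (0 + t * \<tau>)) \<partial>lborel)"
    by (rule nn_integral_cmult[symmetric]) measurable
  also have "\<dots> = (\<integral>\<^sup>+\<tau>. ennreal (beta_kernel \<beta> \<tau> * g (t * \<tau>)) \<partial>lborel)"
  proof (intro nn_integral_cong)
    fix \<tau> :: real
    have ind: "indicat_real {0<..<t} (t * \<tau>) = indicator {0<..<1} \<tau>"
      using assms(4) by (auto simp: indicator_def zero_less_mult_iff)
    show "\<bar>t\<bar> * ennreal (?f (0 + t * \<tau>)) = ennreal (beta_kernel \<beta> \<tau> * g (t * \<tau>))"
    proof (cases "\<tau> \<in> {0<..<1}")
      case True
      have 1: "t - t * \<tau> = t * (1 - \<tau>)" by (simp add: algebra_simps)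
      have "t * ((t * (1 - \<tau>)) powr (\<beta> - 1) * ((t * \<tau>) powr (-\<beta>) * g (t * \<tau>))) =
         (t powr 1 * t powr (-\<beta>) * t powr (\<beta> - 1)) * (\<tau> powr (-\<beta>) * (1 - \<tau>) powr (\<beta> - 1) * g (t * \<tau>))"
        using True assms by (simp add: powr_mult)
      also have "t powr 1 * t powr (-\<beta>) * t powr (\<beta> - 1) = 1"
        using assms by (simp only: powr_add[symmetric]) simp
      finally have eq: "t * ((t * (1 - \<tau>)) powr (\<beta> - 1) * ((t * \<tau>) powr (-\<beta>) * g (t * \<tau>))) =
          beta_kernel \<beta> \<tau> * g (t * \<tau>)"
        using True by (simp add: beta_kernel_def)
      have "\<bar>t\<bar> * ennreal (?f (0 + t * \<tau>)) =
          ennreal (t * ((t * (1 - \<tau>)) powr (\<beta> - 1) * ((t * \<tau>) powr (-\<beta>) * g (t * \<tau>))))"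
        using True assms by (simp add: ind 1 flip: ennreal_mult')
      then show ?thesis by (simp only: eq)
    qed (simp add: ind beta_kernel_def)
  qed
  also have "\<dots> = ennreal (beta_avg \<beta> g t)"
    unfolding beta_avg_def
    using beta_integrand_integrable[OF assms] beta_integrand_nonneg[OF assms(3,4)]
    by (intro nn_integral_eq_integral) auto
  finally show ?thesis .
qed

text \<open>On $(0,t)$ one has $(t-s)^{\beta-1} \ge t^{\beta-1}$, so integrability of the density follows
from that of its product with the fractional kernel.\<close>

lemma density_integrable:
  assumes "0 < \<beta>" "\<beta> < 1" "0 < \<delta>" "profile \<beta> \<delta> K g"
  shows "integrable lborel (\<lambda>s. indicator {0<..<t} s * (s powr (-\<beta>) * g s))"
proof (cases "t > 0")
  case True
  have am: "antimono_on {0<..} g" and nn: "\<And>s. s > 0 \<Longrightarrow> 0 \<le> g s"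
    using assms by (auto simp: profile_def)
  note [measurable] = powr_mult_antimono_measurable[OF am]
  let ?f = "\<lambda>s. indicator {0<..<t} s * (s powr (-\<beta>) * g s)"
  have f0: "0 \<le> ?f s" for s using nn[of s] by (auto simp: indicator_def)
  have le: "t powr (\<beta> - 1) * ?f s \<le> (t - s) powr (\<beta> - 1) * ?f s" for s
  proof (cases "s \<in> {0<..<t}")
    case True
    then have "t powr (\<beta> - 1) \<le> (t - s) powr (\<beta> - 1)"
      using assms by (intro powr_mono2') auto
    then show ?thesis using f0[of s] by (rule mult_right_mono)
  qed simp
  have "(\<integral>\<^sup>+s. ennreal (t powr (\<beta> - 1) * ?f s) \<partial>lborel) \<le>
      (\<integral>\<^sup>+s. ennreal ((t - s) powr (\<beta> - 1) * ?f s) \<partial>lborel)"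
    by (intro nn_integral_mono ennreal_leI le)
  also have "\<dots> < \<infinity>"
    using nn_integral_fractional_eq_beta_avg[OF assms(1,3,4) True] by simp
  finally have "integrable lborel (\<lambda>s. t powr (\<beta> - 1) * ?f s)"
    using f0 by (intro integrableI_nonneg) auto
  then show ?thesis using True by simp
qed (simp add: indicator_def)

text \<open>The semigroup law for fractional integrals of orders $1-\beta$ and $\beta$, by Tonelli's theorem.\<close>

lemma nn_integral_fractional_of_beta_avg:
  assumes "0 < \<beta>" "\<beta> < 1" "0 < \<delta>" "profile \<beta> \<delta> K g"
  shows "(\<integral>\<^sup>+s. ennreal (indicator {0<..<t} s * ((t - s) powr (-\<beta>) * beta_avg \<beta> g s)) \<partial>lborel)
    = ennreal (Beta \<beta> (1 - \<beta>) * (\<integral>s. indicator {0<..<t} s * (s powr (-\<beta>) * g s) \<partial>lborel))"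
proof -
  have am: "antimono_on {0<..} g" and nn: "\<And>s. s > 0 \<Longrightarrow> 0 \<le> g s"
    using assms by (auto simp: profile_def)
  note [measurable] = powr_mult_antimono_measurable[OF am, of t \<beta>]
  let ?f = "\<lambda>r. indicator {0<..<t} r * (r powr (-\<beta>) * g r)"
  have f0: "0 \<le> ?f r" for r using nn[of r] by (auto simp: indicator_def)
  have Bpos: "0 \<le> Beta \<beta> (1 - \<beta>)"
    using assms by (simp add: Beta_def)
  \<comment> \<open>The double integrand on the triangle \<open>0 < r < s < t\<close>, with \<open>r\<close> the inner variable.\<close>
  let ?H = "\<lambda>s r. ennreal (indicator {r<..<t} s * ((t - s) powr (-\<beta>) * (s - r) powr (\<beta> - 1))) * ennreal (?f r)"
  have meas: "case_prod ?H \<in> borel_measurable (lborel \<Otimes>\<^sub>M lborel)"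
  proof -
    have "case_prod ?H = (\<lambda>(s, r). ennreal ((if r < s \<and> s < t then 1 else 0) * ((t - s) powr (-\<beta>) * (s - r) powr (\<beta> - 1))) * ennreal (?f r))"
      by (auto simp: fun_eq_iff indicator_def)
    also have "\<dots> \<in> borel_measurable (lborel \<Otimes>\<^sub>M lborel)" by measurable
    finally show ?thesis .
  qed
  have inner: "(\<integral>\<^sup>+r. ?H s r \<partial>lborel) =
      ennreal (indicator {0<..<t} s * ((t - s) powr (-\<beta>) * beta_avg \<beta> g s))" for s
  proof (cases "s \<in> {0<..<t}")
    case True
    have "(\<integral>\<^sup>+r. ?H s r \<partial>lborel) = (\<integral>\<^sup>+r. ennreal ((t - s) powr (-\<beta>)) *
        ennreal ((s - r) powr (\<beta> - 1) * (indicator {0<..<s} r * (r powr (-\<beta>) * g r))) \<partial>lborel)"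
    proof (intro nn_integral_cong)
      fix r
      show "?H s r = ennreal ((t - s) powr (-\<beta>)) *
        ennreal ((s - r) powr (\<beta> - 1) * (indicator {0<..<s} r * (r powr (-\<beta>) * g r)))"
        using True f0[of r] by (auto simp: indicator_def mult_ac simp flip: ennreal_mult' split: if_splits)
    qed
    also have "\<dots> = ennreal ((t - s) powr (-\<beta>)) * ennreal (beta_avg \<beta> g s)"
    proof -
      note [measurable] = powr_mult_antimono_measurable[OF am, of s \<beta>]
      show ?thesis using True
        by (subst nn_integral_cmult)
           (auto simp: nn_integral_fractional_eq_beta_avg[OF assms(1,3,4)])
    qed
    finally show ?thesis using True by (simp add: ennreal_mult')
  next
    case False
    then have "?H s r = 0" for r by (auto simp: indicator_def)
    then have "(\<integral>\<^sup>+r. ?H s r \<partial>lborel) = (\<integral>\<^sup>+r. 0 \<partial>(lborel :: real measure))"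
      by (intro nn_integral_cong)
    then show ?thesis using False by simp
  qed
  have outer: "(\<integral>\<^sup>+s. ?H s r \<partial>lborel) = ennreal (Beta \<beta> (1 - \<beta>)) * ennreal (?f r)" for r
  proof (cases "r < t")
    case True
    then show ?thesis
      using nn_integral_beta_kernel_shifted[OF assms(1,2) True] by (subst nn_integral_multc) auto
  qed simp
  have "(\<integral>\<^sup>+s. ennreal (indicator {0<..<t} s * ((t - s) powr (-\<beta>) * beta_avg \<beta> g s)) \<partial>lborel)
      = (\<integral>\<^sup>+s. (\<integral>\<^sup>+r. ?H s r \<partial>lborel) \<partial>lborel)"
    by (simp only: inner)
  also have "\<dots> = (\<integral>\<^sup>+r. (\<integral>\<^sup>+s. ?H s r \<partial>lborel) \<partial>lborel)"
    by (rule lborel_pair.Fubini'[OF meas, symmetric])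
  also have "\<dots> = (\<integral>\<^sup>+r. ennreal (Beta \<beta> (1 - \<beta>)) * ennreal (?f r) \<partial>lborel)"
    by (simp only: outer)
  also have "\<dots> = ennreal (Beta \<beta> (1 - \<beta>)) * (\<integral>\<^sup>+r. ennreal (?f r) \<partial>lborel)"
    by (rule nn_integral_cmult) measurable
  also have "(\<integral>\<^sup>+r. ennreal (?f r) \<partial>lborel) = ennreal (\<integral>r. ?f r \<partial>lborel)"
    using density_integrable[OF assms] f0 by (intro nn_integral_eq_integral) auto
  finally show ?thesis using Bpos by (simp add: ennreal_mult')
qed

text \<open>The singular term is $x_0$ times the unnormalized kernel $(s-r)^{\beta-1}$ at $r = 0$, so the
semigroup law turns it into the constant $x_0\Gamma(\beta)$, just as it turns the average into a
primitive.\<close>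

lemma RL_integral_of_volterra:
  assumes "0 < \<beta>" "\<beta> < 1" "0 < \<delta>" "profile \<beta> \<delta> K g" "0 \<le> x0" "0 < t"
    and x: "\<And>s. s > 0 \<Longrightarrow> x s = x0 * s powr (\<beta> - 1) + beta_avg \<beta> g s / Gamma \<beta>"
  shows "RL_integrable (1 - \<beta>) x t"
    and "RL_integral (1 - \<beta>) x t =
           x0 * Gamma \<beta> + (\<integral>s. indicator {0<..<t} s * (s powr (-\<beta>) * g s) \<partial>lborel)"
proof -
  let ?F = "\<integral>s. indicator {0<..<t} s * (s powr (-\<beta>) * g s) \<partial>lborel"
  let ?B = "Beta \<beta> (1 - \<beta>)"
  have G: "Gamma \<beta> > 0" "Gamma (1 - \<beta>) > 0" using assms by auto
  have B: "?B = Gamma \<beta> * Gamma (1 - \<beta>)" by (simp add: Beta_def)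
  have F: "0 \<le> ?F"
    using assms(4) by (intro Bochner_Integration.integral_nonneg) (auto simp: indicator_def profile_def)
  have contA: "continuous_on {0<..} (beta_avg \<beta> g)"
    by (rule beta_avg_continuous[OF assms(1,3,4)])
  have mA: "(\<lambda>s. indicator {0<..<t} s * ((t - s) powr (-\<beta>) * beta_avg \<beta> g s)) \<in> borel_measurable borel"
  proof -
    have [measurable]: "(\<lambda>s. indicator {0<..} s *\<^sub>R beta_avg \<beta> g s) \<in> borel_measurable borel"
      by (rule borel_measurable_continuous_on_indicator[OF _ contA]) simp
    have "(\<lambda>s. indicator {0<..<t} s * ((t - s) powr (-\<beta>) * beta_avg \<beta> g s)) =
       (\<lambda>s. indicator {0<..<t} s * ((t - s) powr (-\<beta>) * (indicator {0<..} s *\<^sub>R beta_avg \<beta> g s)))"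
      by (auto simp: indicator_def)
    also have "\<dots> \<in> borel_measurable borel" by measurable
    finally show ?thesis .
  qed
  have A: "has_bochner_integral lborel
      (\<lambda>s. indicator {0<..<t} s * ((t - s) powr (-\<beta>) * beta_avg \<beta> g s)) (?B * ?F)"
    using mA F G B nn_integral_fractional_of_beta_avg[OF assms(1-4), of t]
      beta_avg_nonneg[OF assms(4)]
    by (intro has_bochner_integral_nn_integral) (auto simp: indicator_def)
  have P: "has_bochner_integral lborel
      (\<lambda>s. indicator {0<..<t} s * ((t - s) powr (-\<beta>) * (s - 0) powr (\<beta> - 1))) ?B"
    using nn_integral_beta_kernel_shifted[OF assms(1,2,6)] G B
    by (intro has_bochner_integral_nn_integral) auto
  have "has_bochner_integral lborel
      (\<lambda>s. x0 * (indicator {0<..<t} s * ((t - s) powr (-\<beta>) * (s - 0) powr (\<beta> - 1))) +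
           1 / Gamma \<beta> * (indicator {0<..<t} s * ((t - s) powr (-\<beta>) * beta_avg \<beta> g s)))
      (x0 * ?B + 1 / Gamma \<beta> * (?B * ?F))"
    by (intro has_bochner_integral_add has_bochner_integral_mult_right A P)
  also have "(\<lambda>s. x0 * (indicator {0<..<t} s * ((t - s) powr (-\<beta>) * (s - 0) powr (\<beta> - 1))) +
           1 / Gamma \<beta> * (indicator {0<..<t} s * ((t - s) powr (-\<beta>) * beta_avg \<beta> g s))) =
     (\<lambda>s. indicator {0<..<t} s * ((t - s) powr (-\<beta>) * x s))"
    by (rule ext) (auto simp: indicator_def x algebra_simps)
  finally have "has_bochner_integral lebesgue
     (\<lambda>s. indicator {0<..<t} s * ((t - s) powr (-\<beta>) * x s)) (x0 * ?B + 1 / Gamma \<beta> * (?B * ?F))"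
    by (auto simp: has_bochner_integral_iff integrable_completion integral_completion)
  then show "RL_integrable (1 - \<beta>) x t"
    and "RL_integral (1 - \<beta>) x t = x0 * Gamma \<beta> + ?F"
    using G unfolding RL_integrable_def RL_integral_def set_integrable_def set_lebesgue_integral_def
    by (auto simp: has_bochner_integral_iff B field_simps)
qed

lemma volterra_solves_RL_equation:
  assumes "0 < \<beta>" "\<beta> < 1" "0 < \<delta>" "profile \<beta> \<delta> K g" "continuous_on {0<..} g" "0 \<le> x0" "0 < t"
    and x: "\<And>s. s > 0 \<Longrightarrow> x s = x0 * s powr (\<beta> - 1) + beta_avg \<beta> g s / Gamma \<beta>"
  shows "has_RL_derivative \<beta> x (t powr (-\<beta>) * g t) t"
proof -
  let ?f = "\<lambda>s. s powr (-\<beta>) * g s"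
  let ?F = "\<lambda>t. \<integral>s. indicator {0<..<t} s * ?f s \<partial>lborel"
  have fi: "integrable lborel (\<lambda>s. indicator {0<..<t} s * ?f s)" for t
    by (rule density_integrable[OF assms(1-4)])
  have f0: "0 \<le> ?f s" if "s > 0" for s using assms(4) that by (simp add: profile_def)
  note RL = RL_integral_of_volterra[OF assms(1-4,6) _ x]
  have "continuous_on {0<..} ?f"
    using assms(5) by (intro continuous_intros) auto
  from indefinite_integral_has_derivative[OF fi this \<open>0 < t\<close>]
  have "((\<lambda>t. x0 * Gamma \<beta> + ?F t) has_real_derivative ?f t) (at t)"
    by (auto intro!: derivative_eq_intros)
  then have "(RL_integral (1 - \<beta>) x has_real_derivative ?f t) (at t)"
    by (rule has_field_derivative_transform_within_open[where S = "{0<..}"]) (use \<open>0 < t\<close> RL(2) in auto)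
  moreover have "abs_continuous_on {0<..T} (RL_integral (1 - \<beta>) x)" for T
    by (rule abs_continuous_on_add_const[OF indefinite_integral_abs_continuous[OF fi f0]])
       (use RL(2) in auto)
  ultimately show ?thesis
    unfolding has_RL_derivative_def using RL(1) by blast
qed

text \<open>The averaged term is $O(t^{\beta+\delta-1})$, hence $o(t^{\beta-1})$.\<close>

lemma volterra_initial_value:
  assumes \<beta>: "0 < \<beta>" and \<delta>: "0 < \<delta>" and pr: "profile \<beta> \<delta> K g"
    and x: "\<And>t. t > 0 \<Longrightarrow> x t = x0 * t powr (\<beta> - 1) + beta_avg \<beta> g t / Gamma \<beta>"
  shows "((\<lambda>t. t powr (1 - \<beta>) * x t) \<longlongrightarrow> x0) (at_right 0)"
proof -
  have G: "Gamma \<beta> > 0" using \<beta> by simp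
  have "((\<lambda>t. t powr (1 - \<beta>) * beta_avg \<beta> g t) \<longlongrightarrow> 0) (at_right 0)"
  proof (rule tendsto_sandwich)
    show "\<forall>\<^sub>F t in at_right 0. 0 \<le> t powr (1 - \<beta>) * beta_avg \<beta> g t"
      using eventually_at_right_less[of 0]
      by eventually_elim (simp add: beta_avg_nonneg[OF pr])
    have "\<forall>\<^sub>F t in at_right (0::real). t \<in> {0<..<1}"
      by (rule eventually_at_right_real) simp
    then show "\<forall>\<^sub>F t in at_right 0. t powr (1 - \<beta>) * beta_avg \<beta> g t \<le> K * Beta \<delta> \<beta> * t powr \<delta>"
    proof eventually_elim
      case (elim t)
      then have "t powr (1 - \<beta>) * beta_avg \<beta> g t \<le> t powr (1 - \<beta>) * (K * t powr (\<beta> + \<delta> - 1) * Beta \<delta> \<beta>)"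
        using beta_avg_bound[OF \<beta> \<delta> pr, of t] by (intro mult_left_mono) (auto simp: min_def)
      also have "\<dots> = K * Beta \<delta> \<beta> * (t powr (1 - \<beta>) * t powr (\<beta> + \<delta> - 1))" by (simp add: mult_ac)
      also have "t powr (1 - \<beta>) * t powr (\<beta> + \<delta> - 1) = t powr \<delta>"
        by (simp flip: powr_add)
      finally show ?case .
    qed
    have "((\<lambda>t::real. t powr \<delta>) \<longlongrightarrow> 0) (at_right 0)"
      using \<delta> by (intro tendsto_zero_powrI[OF _ tendsto_const]) (auto simp: eventually_at_filter intro: tendsto_ident_at)
    then show "((\<lambda>t. K * Beta \<delta> \<beta> * t powr \<delta>) \<longlongrightarrow> 0) (at_right 0)"
      by (rule tendsto_mult_right_zero)
  qed simp
  then have "((\<lambda>t. x0 + t powr (1 - \<beta>) * beta_avg \<beta> g t / Gamma \<beta>) \<longlongrightarrow> x0 + 0 / Gamma \<beta>) (at_right 0)"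
    using G by (intro tendsto_intros) auto
  moreover have "\<forall>\<^sub>F t in at_right 0. x0 + t powr (1 - \<beta>) * beta_avg \<beta> g t / Gamma \<beta> = t powr (1 - \<beta>) * x t"
    using eventually_at_right_less[of 0]
  proof eventually_elim
    case (elim t)
    have "t powr (1 - \<beta>) * t powr (\<beta> - 1) = 1" using elim by (simp flip: powr_add)
    then show ?case using elim by (simp add: x algebra_simps)
  qed
  ultimately show ?thesis using Lim_transform_eventually by fastforce
qed

lemma Cplus_memberI:
  assumes cont: "continuous_on {0<..} x" and nn: "\<And>t. t > 0 \<Longrightarrow> 0 \<le> x t"
    and lim: "((\<lambda>t. t powr \<alpha> * x t) \<longlongrightarrow> c) (at_right 0)" and "0 \<le> c"
  shows "x \<in> Cplus \<alpha>"
proof -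
  define y where "y = (\<lambda>t. if t = 0 then c else t powr \<alpha> * x t)"
  have "continuous_on {0<..} (\<lambda>t. t powr \<alpha> * x t)"
    using cont by (intro continuous_intros) auto
  then have "continuous_on {0<..} y"
    by (rule continuous_on_eq) (auto simp: y_def)
  then have pos: "isCont y t" if "t > 0" for t
    using that by (simp add: continuous_on_eq_continuous_at)
  have "(y \<longlongrightarrow> c) (at_right 0)"
    using lim by (rule Lim_transform_eventually)
      (use eventually_at_right_less[of 0] in \<open>eventually_elim, auto simp: y_def\<close>)
  then have zero: "continuous (at 0 within {0..}) y"
    by (simp add: continuous_within y_def at_within_Ici_at_right)
  have "continuous_on {0..} y"
    unfolding continuous_on_eq_continuous_within
  proof
    fix t :: real assume "t \<in> {0..}"
    then show "continuous (at t within {0..}) y"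
      using zero pos[of t] continuous_at_imp_continuous_at_within by (cases "t = 0") auto
  qed
  then show ?thesis
    unfolding Cplus_def using cont nn \<open>0 \<le> c\<close>
    by (auto intro!: exI[of _ y] simp: y_def)
qed

section \<open>A greatest fixed point among nonincreasing functions\<close>

text \<open>The argument of Knaster and Tarski: the pointwise supremum of all functions $v \le \Phi(v)$ is
again nonincreasing and below $w$, and is a fixed point. Functions are compared on the positive
half line only, so the lattice is not that of the function type.\<close>

lemma greatest_fixpoint_of_antimono_functions:
  fixes w :: "real \<Rightarrow> real" and \<Phi> :: "(real \<Rightarrow> real) \<Rightarrow> real \<Rightarrow> real"
  defines "adm \<equiv> \<lambda>v. antimono_on {0<..} v \<and> (\<forall>t>0. 0 \<le> v t \<and> v t \<le> w t)"
  assumes w: "\<And>t. t > 0 \<Longrightarrow> 0 \<le> w t"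
    and closed: "\<And>v. adm v \<Longrightarrow> adm (\<Phi> v)"
    and mono: "\<And>u v t. adm u \<Longrightarrow> adm v \<Longrightarrow> (\<And>s. s > 0 \<Longrightarrow> u s \<le> v s) \<Longrightarrow> t > 0 \<Longrightarrow> \<Phi> u t \<le> \<Phi> v t"
  shows "\<exists>x. adm x \<and> (\<forall>t>0. x t = \<Phi> x t) \<and>
           (\<forall>v. adm v \<longrightarrow> (\<forall>t>0. v t \<le> \<Phi> v t) \<longrightarrow> (\<forall>t>0. v t \<le> x t))"
proof -
  define S where "S = {v. adm v \<and> (\<forall>t>0. v t \<le> \<Phi> v t)}"
  define x where "x = (\<lambda>t. SUP v\<in>S. v t)"
  have zero: "adm (\<lambda>_. 0)" using w by (auto simp: adm_def monotone_on_def)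
  then have "(\<lambda>_. 0) \<in> S" using closed[OF zero] by (auto simp: S_def adm_def)
  then have ne: "S \<noteq> {}" by blast
  have bdd: "bdd_above ((\<lambda>v. v t) ` S)" if "t > 0" for t
    using that by (intro bdd_aboveI[of _ "w t"]) (auto simp: S_def adm_def)
  have upper: "v t \<le> x t" if "v \<in> S" "t > 0" for v t
    unfolding x_def using that by (intro cSUP_upper bdd)
  have least: "x t \<le> c" if "\<And>v. v \<in> S \<Longrightarrow> v t \<le> c" for t c
    unfolding x_def using that by (intro cSUP_least ne)
  have x_adm: "adm x"
    unfolding adm_def
  proof (intro conjI allI impI monotone_onI)
    fix s t :: real assume st: "s \<in> {0<..}" "t \<in> {0<..}" "s \<le> t"
    show "x t \<le> x s"
    proof (rule least)
      fix v assume v: "v \<in> S"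
      then have "v t \<le> v s"
        using st monotone_onD[of "{0<..}" "(\<le>)" "(\<ge>)" v s t] by (auto simp: S_def adm_def)
      also have "\<dots> \<le> x s" using upper[OF v] st by simp
      finally show "v t \<le> x s" .
    qed
  next
    fix t :: real assume t: "t > 0"
    show "0 \<le> x t" using upper[OF \<open>(\<lambda>_. 0) \<in> S\<close> t] by simp
    show "x t \<le> w t" using t by (intro least) (auto simp: S_def adm_def)
  qed
  have post: "x t \<le> \<Phi> x t" if t: "t > 0" for t
  proof (rule least)
    fix v assume v: "v \<in> S"
    then have "v t \<le> \<Phi> v t" using t by (simp add: S_def)
    also have "\<dots> \<le> \<Phi> x t"
      using v t upper[OF v] x_adm by (intro mono) (auto simp: S_def)
    finally show "v t \<le> \<Phi> x t" .
  qed
  have "\<Phi> x \<in> S"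
    unfolding S_def using closed[OF x_adm] x_adm post by (auto intro: mono)
  then have "x t = \<Phi> x t" if "t > 0" for t
    using upper[of "\<Phi> x" t] post[of t] that by simp
  then show ?thesis
    using x_adm upper by (auto simp: S_def)
qed

text \<open>Supplies the height of the barrier: this is where $\mu < 1$ is used.\<close>

lemma sublinear_eventually_below_identity:
  fixes c d \<mu> :: real
  assumes "\<mu> < 1"
  shows "\<forall>\<^sub>F A in at_top. c + d * A powr \<mu> < A"
proof -
  have "((\<lambda>A. c * A powr (-1) + d * A powr (\<mu> - 1)) \<longlongrightarrow> c * 0 + d * 0) at_top"
    using assms by (intro tendsto_intros tendsto_neg_powr filterlim_ident) auto
  then have "\<forall>\<^sub>F A in at_top. c * A powr (-1) + d * A powr (\<mu> - 1) < 1"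
    by (rule order_tendstoD) simp
  then show ?thesis
    using eventually_gt_at_top[of 0]
  proof eventually_elim
    case (elim A)
    then have "A * (c * A powr (-1) + d * A powr (\<mu> - 1)) < A * 1"
      by (intro mult_strict_left_mono) auto
    also have "A * (c * A powr (-1) + d * A powr (\<mu> - 1)) = c + d * A powr \<mu>"
      using elim by (simp add: powr_diff powr_minus field_simps)
    finally show ?case by simp
  qed
qed

section \<open>Solutions of the fractional problem\<close>

text \<open>The problem with the $L^p$ conditions replaced by the pointwise bounds that they imply. In the
bound on $l$, the factor $(s^{\beta-1})^\mu$ accounts for the growth of $\phi$ along a
solution with the prescribed singularity $s^{\beta-1}$.\<close>

locale fractional_problem =
  fixes \<beta> \<delta> \<mu> M Cl Ck x0 :: real and \<phi> l k :: "real \<Rightarrow> real"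
  assumes \<beta>: "0 < \<beta>" "\<beta> < 1" and \<delta>: "0 < \<delta>" and x0: "x0 > 0"
    and \<mu>: "\<mu> < 1" and M: "0 \<le> M"
    and \<phi>_nonneg: "\<And>y. y \<ge> 0 \<Longrightarrow> 0 \<le> \<phi> y" and \<phi>_cont: "continuous_on {0..} \<phi>"
    and \<phi>_mono: "mono_on {0..} \<phi>" and \<phi>_growth: "\<And>y. y > 0 \<Longrightarrow> \<phi> y \<le> M * y powr \<mu>"
    and l_nonneg: "\<And>s. s > 0 \<Longrightarrow> 0 \<le> s powr \<beta> * l s"
    and l_cont: "continuous_on {0<..} (\<lambda>s. s powr \<beta> * l s)"
    and l_antimono: "antimono_on {0<..} (\<lambda>s. s powr \<beta> * l s)"
    and l_bound: "\<And>s. 0 < s \<Longrightarrow> s \<le> 1 \<Longrightarrow>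
      s powr \<beta> * l s * (s powr (\<beta> - 1)) powr \<mu> \<le> Cl * s powr (\<beta> + \<delta> - 1)"
    and k_nonneg: "\<And>s. s > 0 \<Longrightarrow> 0 \<le> s powr \<beta> * k s"
    and k_cont: "continuous_on {0<..} (\<lambda>s. s powr \<beta> * k s)"
    and k_antimono: "antimono_on {0<..} (\<lambda>s. s powr \<beta> * k s)"
    and k_bound: "\<And>s. 0 < s \<Longrightarrow> s \<le> 1 \<Longrightarrow> s powr \<beta> * k s \<le> Ck * s powr (\<beta> + \<delta> - 1)"
begin

definition source :: "(real \<Rightarrow> real) \<Rightarrow> real \<Rightarrow> real" where
  "source v s = s powr \<beta> * l s * \<phi> (v s) + s powr \<beta> * k s"

definition volterra :: "(real \<Rightarrow> real) \<Rightarrow> real \<Rightarrow> real" where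
  "volterra v t = x0 * t powr (\<beta> - 1) + beta_avg \<beta> (source v) t / Gamma \<beta>"

text \<open>The constant $K$ of the profile belonging to a function below $A$ times the barrier.\<close>

definition source_bound :: "real \<Rightarrow> real" where
  "source_bound A = M * A powr \<mu> * Cl + Ck"

text \<open>Multiples of this function serve as supersolutions: $t^{\beta-1}$ is the singularity at $0$, and
$1$ absorbs solutions that do not tend to $0$ at infinity.\<close>

abbreviation barrier :: "real \<Rightarrow> real" where
  "barrier t \<equiv> max 1 (t powr (\<beta> - 1))"

definition admissible :: "real \<Rightarrow> (real \<Rightarrow> real) \<Rightarrow> bool" where
  "admissible A v \<longleftrightarrow> antimono_on {0<..} v \<and> (\<forall>t>0. 0 \<le> v t \<and> v t \<le> A * barrier t)"

lemma source_profile: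
  assumes "A > 0" "admissible A v"
  shows "profile \<beta> \<delta> (source_bound A) (source v)"
  unfolding profile_def
proof (intro conjI allI impI monotone_onI)
  have v0: "0 \<le> v s" if "s > 0" for s using assms that by (simp add: admissible_def)
  show "0 \<le> source v s" if "s > 0" for s
    unfolding source_def
    by (intro add_nonneg_nonneg mult_nonneg_nonneg[OF l_nonneg] \<phi>_nonneg v0 k_nonneg that)
  fix s :: real
  show "source v t \<le> source v s" if "s \<in> {0<..}" "t \<in> {0<..}" "s \<le> t" for t
  proof -
    have "v t \<le> v s" using assms that by (auto simp: admissible_def monotone_on_def)
    then have "\<phi> (v t) \<le> \<phi> (v s)" using that v0 by (auto intro!: mono_onD[OF \<phi>_mono])
    moreover have "t powr \<beta> * l t \<le> s powr \<beta> * l s" "t powr \<beta> * k t \<le> s powr \<beta> * k s"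
      using monotone_onD[OF l_antimono that] monotone_onD[OF k_antimono that] by auto
    moreover have "t powr \<beta> * l t * \<phi> (v t) \<le> s powr \<beta> * l s * \<phi> (v s)"
      by (rule mult_mono) (use calculation that l_nonneg[of s] \<phi>_nonneg[OF v0, of t] in auto)
    ultimately show ?thesis
      unfolding source_def by linarith
  qed
  assume s: "0 < s \<and> s \<le> 1"
  have "1 powr (\<beta> - 1) \<le> s powr (\<beta> - 1)"
    using s \<beta> by (intro powr_mono2') auto
  then have barrier: "barrier s = s powr (\<beta> - 1)" by (simp add: max_def)
  have "v s \<le> A * barrier s" using assms(2) s unfolding admissible_def by blast
  then have "\<phi> (v s) \<le> \<phi> (A * s powr (\<beta> - 1))"
    using assms(1) s v0[of s] unfolding barrier by (intro mono_onD[OF \<phi>_mono]) auto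
  also have "\<dots> \<le> M * (A * s powr (\<beta> - 1)) powr \<mu>"
    using assms s by (intro \<phi>_growth) auto
  also have "\<dots> = M * A powr \<mu> * (s powr (\<beta> - 1)) powr \<mu>"
    using assms s by (simp add: powr_mult)
  finally have "s powr \<beta> * l s * \<phi> (v s) \<le> s powr \<beta> * l s * (M * A powr \<mu> * (s powr (\<beta> - 1)) powr \<mu>)"
    using l_nonneg[of s] s by (intro mult_left_mono) auto
  also have "\<dots> = M * A powr \<mu> * (s powr \<beta> * l s * (s powr (\<beta> - 1)) powr \<mu>)"
    by (simp add: mult_ac)
  also have "\<dots> \<le> M * A powr \<mu> * (Cl * s powr (\<beta> + \<delta> - 1))"
    using l_bound[of s] s M by (intro mult_left_mono) auto
  finally show "source v s \<le> source_bound A * s powr (\<beta> + \<delta> - 1)"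
    using k_bound[of s] s by (simp add: source_def source_bound_def algebra_simps)
qed

lemma source_continuous:
  assumes "continuous_on {0<..} v" "\<And>s. s > 0 \<Longrightarrow> 0 \<le> v s"
  shows "continuous_on {0<..} (source v)"
proof -
  have "continuous_on {0<..} (\<lambda>s. \<phi> (v s))"
    using assms by (intro continuous_on_compose2[OF \<phi>_cont]) auto
  then show ?thesis
    unfolding source_def by (intro continuous_on_add continuous_on_mult l_cont k_cont)
qed

text \<open>The average is at most a constant times $\min(t,1)^{\beta+\delta-1}$, which lies below the
barrier. The assumption on $A$ ensures that $A$ times the barrier is a supersolution.\<close>

lemma volterra_admissible:
  assumes "A > 0" and A: "x0 + source_bound A * Beta \<delta> \<beta> / Gamma \<beta> \<le> A" and "admissible A v"
  shows "admissible A (volterra v)"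
    and "strict_antimono_on {0<..} (volterra v)"
proof -
  note pr = source_profile[OF assms(1,3)]
  have G: "Gamma \<beta> > 0" using \<beta> by simp
  have B: "Beta \<delta> \<beta> \<ge> 0" using \<beta> \<delta> by (simp add: Beta_def)
  have avg: "beta_avg \<beta> (source v) t / Gamma \<beta> \<le> beta_avg \<beta> (source v) s / Gamma \<beta>" if "0 < s" "s \<le> t" for s t
    using monotone_onD[OF beta_avg_antimono[OF \<beta>(1) \<delta> pr], of s t] that G
    by (simp add: divide_right_mono)
  show strict: "strict_antimono_on {0<..} (volterra v)"
  proof (rule monotone_onI)
    fix s t :: real assume st: "s \<in> {0<..}" "t \<in> {0<..}" "s < t"
    then have "t powr (\<beta> - 1) < s powr (\<beta> - 1)"
      using \<beta> by (intro powr_less_mono2_neg) auto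
    then have "x0 * t powr (\<beta> - 1) < x0 * s powr (\<beta> - 1)" using x0 by simp
    then show "volterra v t < volterra v s"
      unfolding volterra_def using avg[of s t] st by simp
  qed
  show "admissible A (volterra v)"
    unfolding admissible_def
  proof (intro conjI allI impI monotone_onI)
    fix s t :: real assume "s \<in> {0<..}" "t \<in> {0<..}" "s \<le> t"
    then show "volterra v t \<le> volterra v s"
      using monotone_onD[OF strict, of s t] by (cases "s = t") auto
  next
    fix t :: real assume t: "t > 0"
    show "0 \<le> volterra v t"
      unfolding volterra_def using x0 beta_avg_nonneg[OF pr t] G by simp
    have K: "0 \<le> source_bound A"
      by (rule profile_const_nonneg[OF pr])
    have "min t 1 powr (\<beta> + \<delta> - 1) \<le> barrier t"
    proof (cases "t \<le> 1")
      case True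
      have "t powr (\<beta> + \<delta> - 1) \<le> t powr (\<beta> - 1)"
        using True t \<delta> by (intro powr_mono') auto
      then show ?thesis using True by (simp add: min_def le_max_iff_disj)
    qed (simp add: min_def)
    then have "source_bound A * min t 1 powr (\<beta> + \<delta> - 1) * Beta \<delta> \<beta> \<le> source_bound A * barrier t * Beta \<delta> \<beta>"
      using K B by (intro mult_right_mono mult_left_mono)
    then have "beta_avg \<beta> (source v) t \<le> source_bound A * barrier t * Beta \<delta> \<beta>"
      using beta_avg_bound[OF \<beta>(1) \<delta> pr t] by linarith
    then have "beta_avg \<beta> (source v) t / Gamma \<beta> \<le> source_bound A * barrier t * Beta \<delta> \<beta> / Gamma \<beta>"
      using G by (intro divide_right_mono) auto
    moreover have "x0 * t powr (\<beta> - 1) \<le> x0 * barrier t"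
      using x0 by (intro mult_left_mono) auto
    ultimately have "volterra v t \<le> x0 * barrier t + source_bound A * barrier t * Beta \<delta> \<beta> / Gamma \<beta>"
      unfolding volterra_def by linarith
    also have "\<dots> = (x0 + source_bound A * Beta \<delta> \<beta> / Gamma \<beta>) * barrier t"
      by (simp only: ring_distribs times_divide_eq_left times_divide_eq_right mult_ac)
    also have "\<dots> \<le> A * barrier t"
      using A by (intro mult_right_mono) auto
    finally show "volterra v t \<le> A * barrier t" .
  qed
qed

lemma volterra_mono:
  assumes "A > 0" "admissible A u" "admissible A v" "\<And>s. s > 0 \<Longrightarrow> u s \<le> v s" "t > 0"
  shows "volterra u t \<le> volterra v t"
proof -
  have "source u s \<le> source v s" if "s > 0" for s
  proof -
    have "u s \<in> {0..}" "v s \<in> {0..}" using assms(2,3) that by (simp_all add: admissible_def)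
    then have "\<phi> (u s) \<le> \<phi> (v s)" using assms(4)[OF that] by (rule mono_onD[OF \<phi>_mono])
    then have "s powr \<beta> * l s * \<phi> (u s) \<le> s powr \<beta> * l s * \<phi> (v s)"
      by (rule mult_left_mono[OF _ l_nonneg[OF that]])
    then show ?thesis
      unfolding source_def by (rule add_right_mono)
  qed
  then have "beta_avg \<beta> (source u) t \<le> beta_avg \<beta> (source v) t"
    by (rule beta_avg_mono[OF \<beta>(1) \<delta> source_profile[OF assms(1,2)] source_profile[OF assms(1,3)] assms(5)])
  then have "beta_avg \<beta> (source u) t / Gamma \<beta> \<le> beta_avg \<beta> (source v) t / Gamma \<beta>"
    by (rule divide_right_mono) (use Gamma_real_pos[OF \<beta>(1)] in simp)
  then show ?thesis
    unfolding volterra_def by (rule add_left_mono)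
qed

lemma volterra_fixpoint_solves:
  assumes "A > 0" "x0 + source_bound A * Beta \<delta> \<beta> / Gamma \<beta> \<le> A" "admissible A x"
    and fixp: "\<And>t. t > 0 \<Longrightarrow> x t = volterra x t"
  shows "x \<in> Cplus (1 - \<beta>)" "RL_ivp_solution \<beta> l k \<phi> x0 x" "strict_antimono_on {0<..} x"
proof -
  note pr = source_profile[OF assms(1,3)]
  have x: "x t = x0 * t powr (\<beta> - 1) + beta_avg \<beta> (source x) t / Gamma \<beta>" if "t > 0" for t
    using fixp[OF that] by (simp add: volterra_def)
  have nn: "0 \<le> x t" if "t > 0" for t using assms(3) that by (simp add: admissible_def)
  have "continuous_on {0<..} (volterra x)"
    unfolding volterra_def using Gamma_real_pos[OF \<beta>(1)]
    by (intro continuous_intros beta_avg_continuous[OF \<beta>(1) \<delta> pr]) auto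
  then have cont: "continuous_on {0<..} x"
    by (rule continuous_on_eq) (simp add: fixp)
  have ini: "((\<lambda>t. t powr (1 - \<beta>) * x t) \<longlongrightarrow> x0) (at_right 0)"
    by (rule volterra_initial_value[OF \<beta>(1) \<delta> pr x])
  show "x \<in> Cplus (1 - \<beta>)"
    using x0 by (intro Cplus_memberI[OF cont nn ini]) auto
  show "strict_antimono_on {0<..} x"
    using volterra_admissible(2)[OF assms(1-3)] fixp by (simp add: monotone_on_def)
  have "has_RL_derivative \<beta> x (l t * \<phi> (x t) + k t) t" if t: "t > 0" for t
  proof -
    have "has_RL_derivative \<beta> x (t powr (-\<beta>) * source x t) t"
      using x0 by (intro volterra_solves_RL_equation[OF \<beta> \<delta> pr source_continuous[OF cont nn] _ t x]) auto
    also have "t powr (-\<beta>) * source x t = (t powr (-\<beta>) * t powr \<beta>) * (l t * \<phi> (x t) + k t)"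
      by (simp add: source_def algebra_simps)
    also have "t powr (-\<beta>) * t powr \<beta> = 1" using t by (simp flip: powr_add)
    finally show ?thesis by simp
  qed
  then show "RL_ivp_solution \<beta> l k \<phi> x0 x"
    using ini by (simp add: RL_ivp_solution_def)
qed

lemma volterra_fixpoint_limit:
  assumes "A > 0" "admissible A x" and fixp: "\<And>t. t > 0 \<Longrightarrow> x t = volterra x t"
    and L: "(x \<longlongrightarrow> L) at_top" "L \<ge> 0"
    and a: "((\<lambda>t. t powr \<beta> * l t) \<longlongrightarrow> a) at_top" and b: "((\<lambda>t. t powr \<beta> * k t) \<longlongrightarrow> b) at_top"
  shows "L = Beta (1 - \<beta>) \<beta> / Gamma \<beta> * (a * \<phi> L + b)"
proof -
  have nn: "\<forall>\<^sub>F t in at_top. x t \<in> {0..}"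
    using eventually_gt_at_top[of 0] by eventually_elim (use assms(2) in \<open>simp add: admissible_def\<close>)
  have "((\<lambda>t. \<phi> (x t)) \<longlongrightarrow> \<phi> L) at_top"
    using L nn by (intro continuous_on_tendsto_compose[OF \<phi>_cont L(1)]) auto
  then have "(source x \<longlongrightarrow> a * \<phi> L + b) at_top"
    unfolding source_def by (intro tendsto_intros a b)
  from beta_avg_at_top[OF \<beta> \<delta> source_profile[OF assms(1,2)] this]
  have "((\<lambda>t. x0 * t powr (\<beta> - 1) + beta_avg \<beta> (source x) t / Gamma \<beta>) \<longlongrightarrow>
      x0 * 0 + Beta (1 - \<beta>) \<beta> * (a * \<phi> L + b) / Gamma \<beta>) at_top"
    using \<beta> Gamma_real_pos[OF \<beta>(1), THEN less_imp_neq]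
    by (intro tendsto_intros tendsto_neg_powr filterlim_ident) auto
  moreover have "\<forall>\<^sub>F t in at_top. x0 * t powr (\<beta> - 1) + beta_avg \<beta> (source x) t / Gamma \<beta> = x t"
    using eventually_gt_at_top[of 0] by eventually_elim (simp add: fixp[symmetric] flip: volterra_def)
  ultimately have "(x \<longlongrightarrow> x0 * 0 + Beta (1 - \<beta>) \<beta> * (a * \<phi> L + b) / Gamma \<beta>) at_top"
    by (rule Lim_transform_eventually)
  from tendsto_unique[OF _ L(1) this] show ?thesis by simp
qed

text \<open>The average of the constant $a\phi(y)+b$ against the kernel, divided by $\Gamma(\beta)$, is $y$
itself, and $t^\beta l(t) \ge a$ and $t^\beta k(t) \ge b$ by monotonicity.\<close>

lemma constant_subsolution:
  assumes "A > 0" "0 \<le> y" "y \<le> A" and y: "y = Beta (1 - \<beta>) \<beta> / Gamma \<beta> * (a * \<phi> y + b)"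
    and a: "((\<lambda>t. t powr \<beta> * l t) \<longlongrightarrow> a) at_top" and b: "((\<lambda>t. t powr \<beta> * k t) \<longlongrightarrow> b) at_top"
  shows "admissible A (\<lambda>_. y)" and "t > 0 \<Longrightarrow> y \<le> volterra (\<lambda>_. y) t"
proof -
  have "y \<le> A * barrier t" for t
    using assms(1,3) mult_left_mono[OF max.cobounded1[of 1 "t powr (\<beta> - 1)"], of A] by linarith
  then show adm: "admissible A (\<lambda>_. y)"
    using assms(2) by (auto simp: admissible_def monotone_on_def)
  assume t: "t > 0"
  have "a * \<phi> y + b \<le> source (\<lambda>_. y) s" if "s > 0" for s
    unfolding source_def using that assms(2)
    by (intro add_mono mult_right_mono \<phi>_nonneg
        antimono_limit_lower_bound[OF l_antimono a] antimono_limit_lower_bound[OF k_antimono b])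
  from beta_avg_lower_bound[OF \<beta> \<delta> source_profile[OF assms(1) adm] t this]
  have "Beta (1 - \<beta>) \<beta> * (a * \<phi> y + b) / Gamma \<beta> \<le> beta_avg \<beta> (source (\<lambda>_. y)) t / Gamma \<beta>"
    using \<beta> by (intro divide_right_mono) auto
  moreover have "0 \<le> x0 * t powr (\<beta> - 1)" using x0 by simp
  ultimately show "y \<le> volterra (\<lambda>_. y) t"
    using y unfolding volterra_def by (simp del: mult_nonneg_nonneg)
qed

text \<open>Besides giving a supersolution, $A$ has to exceed every fixed point of the limit equation, so that
the corresponding constant functions are admissible and lie below the greatest fixed point.\<close>

lemma barrier_height_exists:
  fixes a b :: real
  assumes "0 \<le> a"
  shows "\<exists>A>0. x0 + source_bound A * Beta \<delta> \<beta> / Gamma \<beta> \<le> A \<and>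
     (\<forall>y\<ge>0. y = Beta (1 - \<beta>) \<beta> / Gamma \<beta> * (a * \<phi> y + b) \<longrightarrow> y \<le> A)"
proof -
  let ?c = "Beta (1 - \<beta>) \<beta> / Gamma \<beta>"
  have c: "0 \<le> ?c" using \<beta> by (simp add: Beta_def)
  have 1: "\<forall>\<^sub>F A in at_top. x0 + Ck * Beta \<delta> \<beta> / Gamma \<beta> + M * Cl * Beta \<delta> \<beta> / Gamma \<beta> * A powr \<mu> < A"
    by (rule sublinear_eventually_below_identity[OF \<mu>])
  have 2: "\<forall>\<^sub>F A in at_top. ?c * b + ?c * a * M * A powr \<mu> < A"
    by (rule sublinear_eventually_below_identity[OF \<mu>])
  obtain A0 where A0: "\<And>A. A \<ge> A0 \<Longrightarrow>
      x0 + Ck * Beta \<delta> \<beta> / Gamma \<beta> + M * Cl * Beta \<delta> \<beta> / Gamma \<beta> * A powr \<mu> < A \<and>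
      ?c * b + ?c * a * M * A powr \<mu> < A"
    using eventually_conj[OF 1 2] unfolding eventually_at_top_linorder by blast
  define A where "A = max A0 1"
  have A: "A > 0" "A \<ge> A0" by (auto simp: A_def)
  have "x0 + source_bound A * Beta \<delta> \<beta> / Gamma \<beta> \<le> A"
    using A0[OF A(2)] by (simp add: source_bound_def algebra_simps add_divide_distrib)
  moreover have "y \<le> A" if "y \<ge> 0" and y: "y = ?c * (a * \<phi> y + b)" for y
  proof (rule ccontr)
    assume "\<not> y \<le> A"
    then have y': "y > 0" "y \<ge> A0" using A by auto
    have "y \<le> ?c * (a * (M * y powr \<mu>) + b)"
      using y c assms \<phi>_growth[OF y'(1)] by (metis add_right_mono mult_left_mono)
    also have "\<dots> = ?c * b + ?c * a * M * y powr \<mu>" by (simp only: algebra_simps)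
    also have "\<dots> < y" using A0[OF y'(2)] by blast
    finally show False by simp
  qed
  ultimately show ?thesis using A by blast
qed

text \<open>The greatest fixed point of the Volterra operator lies above every solution $y$ of the limit
equation, so its limit at infinity does too; solving that equation itself, the limit is its
largest solution.\<close>

theorem decreasing_solution_exists:
  assumes a: "((\<lambda>t. t powr \<beta> * l t) \<longlongrightarrow> a) at_top" and b: "((\<lambda>t. t powr \<beta> * k t) \<longlongrightarrow> b) at_top"
  shows "\<exists>xstar. largest_nonneg_solution (\<lambda>y. Beta (1 - \<beta>) \<beta> / Gamma \<beta> * (a * \<phi> y + b)) xstar \<and>
           (\<exists>x \<in> Cplus (1 - \<beta>). RL_ivp_solution \<beta> l k \<phi> x0 x \<and>
              strict_antimono_on {0<..} x \<and> (x \<longlongrightarrow> xstar) at_top)"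
proof -
  have "a \<ge> 0"
    by (rule tendsto_lowerbound[OF a]) (auto intro!: eventually_mono[OF eventually_gt_at_top[of 0]] l_nonneg)
  then obtain A where A: "A > 0" "x0 + source_bound A * Beta \<delta> \<beta> / Gamma \<beta> \<le> A"
    and A_fix: "\<And>y. y \<ge> 0 \<Longrightarrow> y = Beta (1 - \<beta>) \<beta> / Gamma \<beta> * (a * \<phi> y + b) \<Longrightarrow> y \<le> A"
    using barrier_height_exists[of a b] by blast
  have "\<exists>x. admissible A x \<and> (\<forall>t>0. x t = volterra x t) \<and>
      (\<forall>v. admissible A v \<longrightarrow> (\<forall>t>0. v t \<le> volterra v t) \<longrightarrow> (\<forall>t>0. v t \<le> x t))"
    using greatest_fixpoint_of_antimono_functions[of "\<lambda>t. A * barrier t" volterra, folded admissible_def]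
      A(1) volterra_admissible(1)[OF A] volterra_mono[OF A(1)] by auto
  then obtain x where x: "admissible A x" and fixp: "\<And>t. t > 0 \<Longrightarrow> x t = volterra x t"
    and greatest: "\<And>v t. admissible A v \<Longrightarrow> (\<And>t. t > 0 \<Longrightarrow> v t \<le> volterra v t) \<Longrightarrow> t > 0 \<Longrightarrow> v t \<le> x t"
    by blast
  obtain L where L: "L \<ge> 0" "(x \<longlongrightarrow> L) at_top"
    using antimono_nonneg_convergent[of x] x by (auto simp: admissible_def)
  have "y \<le> L" if y: "y \<ge> 0" "y = Beta (1 - \<beta>) \<beta> / Gamma \<beta> * (a * \<phi> y + b)" for y
  proof (rule tendsto_lowerbound[OF L(2)])
    note sub = constant_subsolution[OF A(1) y(1) A_fix[OF y] y(2) a b]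
    show "\<forall>\<^sub>F t in at_top. y \<le> x t"
      using eventually_gt_at_top[of 0] by eventually_elim (rule greatest[OF sub])
  qed simp
  then have "largest_nonneg_solution (\<lambda>y. Beta (1 - \<beta>) \<beta> / Gamma \<beta> * (a * \<phi> y + b)) L"
    using volterra_fixpoint_limit[OF A(1) x fixp L(2,1) a b] L(1)
    by (auto simp: largest_nonneg_solution_def)
  then show ?thesis
    using volterra_fixpoint_solves[OF A x fixp] L(2) by blast
qed

end

text \<open>Take $\delta = \beta - 1/p$. Both $L^p$ conditions become bounds by multiples of
$s^{2\beta-1} s^{-1/p} = s^{\beta+\delta-1}$.\<close>

theorem theorem3p5:
  fixes \<beta> x0 \<mu> p M a b :: real and \<phi> l k :: "real \<Rightarrow> real"
  assumes "0 < \<beta>" "\<beta> < 1" and "x0 > 0" and "0 \<le> \<mu>" "\<mu> < 1" and "p > 1 / \<beta>"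
    and "\<forall>t\<ge>0. 0 \<le> \<phi> t" and "continuous_on {0..} \<phi>" and "mono_on {0..} \<phi>"
    and "0 \<le> M" and "\<forall>t\<ge>0. \<bar>\<phi> t\<bar> \<le> M * rpow t \<mu>"
    and "\<forall>t>0. 0 \<le> t powr \<beta> * l t"
    and "continuous_on {0<..} (\<lambda>t. t powr \<beta> * l t)"
    and "antimono_on {0<..} (\<lambda>t. t powr \<beta> * l t)"
    and "in_Lp p {0..1} (\<lambda>t. t powr ((1 - \<mu>) * (1 - \<beta>)) * l t)"
    and "\<forall>t>0. 0 \<le> t powr \<beta> * k t"
    and "continuous_on {0<..} (\<lambda>t. t powr \<beta> * k t)"
    and "antimono_on {0<..} (\<lambda>t. t powr \<beta> * k t)"
    and "in_Lp p {0..1} (\<lambda>t. t powr (1 - \<beta>) * k t)"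
    and "((\<lambda>t. t powr \<beta> * l t) \<longlongrightarrow> a) at_top"
    and "((\<lambda>t. t powr \<beta> * k t) \<longlongrightarrow> b) at_top"
  shows "\<exists>xstar. largest_nonneg_solution
             (\<lambda>x. pi / (Gamma \<beta> * sin (\<beta> * pi)) * (a * \<phi> x + b)) xstar \<and>
           (\<exists>x \<in> Cplus (1 - \<beta>). RL_ivp_solution \<beta> l k \<phi> x0 x \<and>
              strict_antimono_on {0<..} x \<and> (x \<longlongrightarrow> xstar) at_top)"
proof -
  have "1 / \<beta> > 0" using assms(1) by simp
  then have p: "p > 0" using assms(6) by linarith
  define \<delta> where "\<delta> = \<beta> - 1 / p"
  have \<delta>: "\<delta> > 0" using assms(1,6) p by (simp add: \<delta>_def field_simps)
  have nonneg: "y \<ge> 0 \<Longrightarrow> 0 \<le> \<phi> y" "s > 0 \<Longrightarrow> 0 \<le> s powr \<beta> * l s" "s > 0 \<Longrightarrow> 0 \<le> s powr \<beta> * k s" for y s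
    using assms(7,12,16) by blast+
  obtain Cl where Cl: "\<And>s. 0 < s \<Longrightarrow> s \<le> 1 \<Longrightarrow> s powr ((1 - \<mu>) * (1 - \<beta>)) * l s \<le> Cl * s powr (- 1 / p)"
    using Lp_antimono_pointwise_bound[OF p nonneg(2) assms(14,15)] by blast
  obtain Ck where Ck: "\<And>s. 0 < s \<Longrightarrow> s \<le> 1 \<Longrightarrow> s powr (1 - \<beta>) * k s \<le> Ck * s powr (- 1 / p)"
    using Lp_antimono_pointwise_bound[OF p nonneg(3) assms(18,19)] by blast
  interpret fractional_problem \<beta> \<delta> \<mu> M Cl Ck x0 \<phi> l k
  proof
    show "\<phi> y \<le> M * y powr \<mu>" if "y > 0" for y
      using assms(11)[rule_format, of y] that by (simp add: rpow_def split: if_splits)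
    fix s :: real assume s: "0 < s" "s \<le> 1"
    have "s powr \<beta> * l s * (s powr (\<beta> - 1)) powr \<mu> =
        s powr (2 * \<beta> - 1) * (s powr ((1 - \<mu>) * (1 - \<beta>)) * l s)"
    proof -
      have "s powr \<beta> * (s powr (\<beta> - 1)) powr \<mu> = s powr (2 * \<beta> - 1) * s powr ((1 - \<mu>) * (1 - \<beta>))"
        unfolding powr_powr powr_add[symmetric] by (simp add: algebra_simps)
      then show ?thesis by (simp add: mult_ac)
    qed
    also have "\<dots> \<le> s powr (2 * \<beta> - 1) * (Cl * s powr (- 1 / p))"
      using Cl[OF s] by (intro mult_left_mono) auto
    also have "\<dots> = Cl * (s powr (2 * \<beta> - 1) * s powr (- 1 / p))" by (simp add: mult_ac)
    also have "s powr (2 * \<beta> - 1) * s powr (- 1 / p) = s powr (\<beta> + \<delta> - 1)"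
      unfolding powr_add[symmetric] by (simp add: \<delta>_def algebra_simps)
    finally show "s powr \<beta> * l s * (s powr (\<beta> - 1)) powr \<mu> \<le> Cl * s powr (\<beta> + \<delta> - 1)" .
    have "s powr \<beta> * k s = s powr (2 * \<beta> - 1) * (s powr (1 - \<beta>) * k s)"
      unfolding mult.assoc[symmetric] powr_add[symmetric] by simp
    also have "\<dots> \<le> s powr (2 * \<beta> - 1) * (Ck * s powr (- 1 / p))"
      using Ck[OF s] by (intro mult_left_mono) auto
    also have "\<dots> = Ck * (s powr (2 * \<beta> - 1) * s powr (- 1 / p))" by (simp add: mult_ac)
    also have "s powr (2 * \<beta> - 1) * s powr (- 1 / p) = s powr (\<beta> + \<delta> - 1)"
      unfolding powr_add[symmetric] by (simp add: \<delta>_def algebra_simps)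
    finally show "s powr \<beta> * k s \<le> Ck * s powr (\<beta> + \<delta> - 1)" .
  qed (fact \<delta> assms nonneg)+
  have "Beta (1 - \<beta>) \<beta> / Gamma \<beta> = pi / (Gamma \<beta> * sin (\<beta> * pi))"
    using Beta_reflection_real[of \<beta>] by (simp add: Beta_def mult.commute)
  then show ?thesis
    using decreasing_solution_exists[OF assms(20,21)] by simp
qed

end
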